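(* Let $k\ge 2$ be an integer and let $(M^{2k},g)$ be a pseudo-Riemannian manifold of dimension $2k$. Let $\Upsilon\in C^\infty(M)$ and set $\widehat g:=e^{2\Upsilon}g$. Then $$e^{2k\Upsilon}\,\widehat{\xi}{}_i^{(k)}=\xi_i^{(k)},$$ where $\xi_i^{(k)}$ and $\widehat\xi{}_i^{(k)}$ are the one-forms defined in the context in terms of $g$ and $\widehat g$, respectively. Moreover, if $M$ is oriented and $\Phi$ is a homogeneous invariant polynomial of degree $k$, then $$e^{2k\Upsilon}\,\widehat{\rho}{}_i^{\Phi}=\rho_i^{\Phi},$$ where $\rho_i^\Phi$ and $\widehat\rho{}_i^\Phi$ are the one-forms defined in the context in terms of $g$ and $\widehat g$, respectively.
   Context: Abstract index notation is used; indices are raised and lowered with the metric and repeated indices are contracted. $\nabla$ is the Levi-Civita connection of the metric, $R_{ij}{}^k{}_\ell X^\ell=\nabla_i\nabla_jX^k-\nabla_j\nabla_iX^k$, $R_{ij}=R_{ki}{}^k{}_j$, $R=R_k{}^k$, $n=\dim M$. The Schouten tensor is $P_{ij}=\frac1{n-2}(R_{ij}-Jg_{ij})$ with $J=\frac{R}{2(n-1)}$. The Weyl tensor $W_{ijkl}$ is given by $R_{ijkl}=W_{ijkl}+P_{ik}g_{jl}-P_{il}g_{jk}+P_{jl}g_{ik}-P_{jk}g_{il}$. The Cotton tensor is $C_{ijk}=\nabla_iP_{jk}-\nabla_jP_{ik}$, so that $\nabla^pW_{ijpq}=(n-3)C_{ijq}$. The generalized Kronecker delta is $\delta_{i_1\cdots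 i_m}^{j_1\cdots j_m}=\sum_{\sigma\in S_m}\mathrm{sgn}(\sigma)\,\delta_{i_1}^{j_{\sigma(1)}}\cdots\delta_{i_m}^{j_{\sigma(m)}}$. With $n=2k$, define $$\mathrm{Pf}^{(k)}(W)=\frac1{k!}\delta_{i_1\cdots i_{2k}}^{j_1\cdots j_{2k}}W_{j_1j_2}{}^{i_1i_2}\cdots W_{j_{2k-1}j_{2k}}{}^{i_{2k-1}i_{2k}},$$ $$\xi_i^{(k)}=\frac1{k!}\delta_{ii_2\cdots i_{2k}}^{jj_2\cdots j_{2k}}C_{jj_2}{}^{i_2}W_{j_3j_4}{}^{i_3i_4}\cdots W_{j_{2k-1}j_{2k}}{}^{i_{2k-1}i_{2k}}+\frac{1}{2nk}\nabla_i\mathrm{Pf}^{(k)}(W).$$ A homogeneous invariant polynomial of degree $k$ is a tensor $\Phi_{i_1\cdots i_k}^{j_1\cdots j_k}$ that is a linear combination of compositions of $\mathrm{Id}^{\otimes k}$ with braiding maps, i.e. of the tensors $\delta_{i_1}^{j_{\pi(1)}}\cdots\delta_{i_k}^{j_{\pi(k)}}$, $\pi\in S_k$, and satisfies $\Phi_{i_1\cdots i_k}^{j_1\cdots j_k}=\Phi_{i_{\sigma(1)}\cdots i_{\sigma(k)}}^{j_{\sigma(1)}\cdots j_{\sigma(k)}}$ for all $\sigma\in S_k$. If $M^{2k}$ is oriented with pseudo-Riemannian volume form $\epsilon_{i_1\cdots i_{2k}}$, define $$p_\Phi(W)=\frac1{(2k)!}\epsilon^{i_1\cdots i_{2k}}\Phi_{s_1\cdots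 s_k}^{t_1\cdots t_k}W_{t_1}{}^{s_1}{}_{i_1i_2}\cdots W_{t_k}{}^{s_k}{}_{i_{2k-1}i_{2k}},$$ $$\rho_i^\Phi=\frac1{(2k-1)!}\epsilon_i{}^{i_2\cdots i_{2k}}\Phi_{s_1\cdots s_k}^{t_1\cdots t_k}C_{t_1}{}^{s_1}{}_{i_2}W_{t_2}{}^{s_2}{}_{i_3i_4}\cdots W_{t_k}{}^{s_k}{}_{i_{2k-1}i_{2k}}+\frac1{2k}\nabla_ip_\Phi(W).$$ *)

theory Defs
  imports "HOL-Analysis.Analysis" "HOL-Combinatorics.Combinatorics"
begin

section \<open>Smooth functions on open subsets of Euclidean space\<close>

definition pd :: "'n::finite \<Rightarrow> (real^'n \<Rightarrow> real) \<Rightarrow> real^'n \<Rightarrow> real" where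
  "pd i f x = frechet_derivative f (at x) (axis i 1)"

text \<open>Meant for open sets \<open>S\<close>.\<close>

primrec Ck_on :: "nat \<Rightarrow> (real^'n::finite) set \<Rightarrow> (real^'n \<Rightarrow> real) \<Rightarrow> bool" where
  "Ck_on 0 S f \<longleftrightarrow> continuous_on S f"
| "Ck_on (Suc r) S f \<longleftrightarrow> f differentiable_on S \<and> (\<forall>i. Ck_on r S (pd i f))"

definition smooth_on :: "(real^'n::finite) set \<Rightarrow> (real^'n \<Rightarrow> real) \<Rightarrow> bool" where
  "smooth_on S f \<longleftrightarrow> (\<forall>r. Ck_on r S f)"


section \<open>Smooth manifolds, metrics, orientations\<close>

text \<open>A chart \<open>(U, \<phi>)\<close>; only the values of \<open>\<phi>\<close> on \<open>U\<close> matter.\<close>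

type_synonym ('a, 'n) chart = "'a set \<times> ('a \<Rightarrow> real^'n)"

abbreviation cdom :: "('a, 'n::finite) chart \<Rightarrow> 'a set" where
  "cdom c \<equiv> fst c"

abbreviation coord :: "('a, 'n::finite) chart \<Rightarrow> 'a \<Rightarrow> real^'n" where
  "coord c \<equiv> snd c"

definition point :: "('a, 'n::finite) chart \<Rightarrow> real^'n \<Rightarrow> 'a" where
  "point c = inv_into (cdom c) (coord c)"

definition transition :: "('a, 'n::finite) chart \<Rightarrow> ('a, 'n) chart \<Rightarrow> real^'n \<Rightarrow> real^'n" where
  "transition c d = coord d \<circ> point c"

text \<open>A smooth manifold of dimension \<open>CARD('n)\<close> with point set \<open>topspace X\<close>. The atlas \<open>A\<close> need
  not be maximal, but may be.\<close>

definition smooth_manifold :: "'a topology \<Rightarrow> ('a, 'n::finite) chart set \<Rightarrow> bool" where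
  "smooth_manifold X A \<longleftrightarrow>
     Hausdorff_space X \<and> second_countable X \<and> (\<Union>c\<in>A. cdom c) = topspace X \<and>
     (\<forall>c\<in>A. openin X (cdom c) \<and> open (coord c ` cdom c) \<and>
        homeomorphic_map (subtopology X (cdom c)) (top_of_set (coord c ` cdom c)) (coord c)) \<and>
     (\<forall>c\<in>A. \<forall>d\<in>A. \<forall>i.
        smooth_on (coord c ` (cdom c \<inter> cdom d)) (\<lambda>x. transition c d x $ i))"

definition smooth_function :: "('a, 'n::finite) chart set \<Rightarrow> ('a \<Rightarrow> real) \<Rightarrow> bool" where
  "smooth_function A f \<longleftrightarrow> (\<forall>c\<in>A. smooth_on (coord c ` cdom c) (f \<circ> point c))"

text \<open>Tensor fields are given by their component functions in each chart. For the metric,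
  \<open>g c x $ i $ j\<close> is the component $g_{ij}$ in the chart \<open>c\<close> at the coordinate value \<open>x\<close>, and the last
  conjunct is the transformation law
  $g_{ij} = \partial_i y^a\, \partial_j y^b\, g'_{ab}$ of a covariant 2-tensor.\<close>

definition pseudo_riemannian_metric ::
    "('a, 'n::finite) chart set \<Rightarrow> (('a, 'n) chart \<Rightarrow> real^'n \<Rightarrow> real^'n^'n) \<Rightarrow> bool" where
  "pseudo_riemannian_metric A g \<longleftrightarrow>
     (\<forall>c\<in>A. (\<forall>i j. smooth_on (coord c ` cdom c) (\<lambda>x. g c x $ i $ j)) \<and>
        (\<forall>x \<in> coord c ` cdom c. transpose (g c x) = g c x \<and> invertible (g c x))) \<and>
     (\<forall>c\<in>A. \<forall>d\<in>A. \<forall>p \<in> cdom c \<inter> cdom d.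
        (let D = jacobian (transition c d) (at (coord c p))
         in g c (coord c p) = transpose D ** g d (coord d p) ** D))"

definition conformal_change ::
    "('a \<Rightarrow> real) \<Rightarrow> (('a, 'n::finite) chart \<Rightarrow> real^'n \<Rightarrow> real^'n^'n)
      \<Rightarrow> (('a, 'n) chart \<Rightarrow> real^'n \<Rightarrow> real^'n^'n)" where
  "conformal_change \<Upsilon> g c x = exp (2 * \<Upsilon> (point c x)) *\<^sub>R g c x"

text \<open>An orientation: \<open>ori c x\<close> is \<open>1\<close> or \<open>-1\<close> according to whether the coordinate frame of \<open>c\<close>,
  ordered as in \<open>frame_index\<close> below, is positively or negatively oriented at \<open>x\<close>. For an atlas
  of positively oriented charts \<open>ori\<close> is constantly \<open>1\<close>.\<close>

definition orientation ::
    "('a, 'n::finite) chart set \<Rightarrow> (('a, 'n) chart \<Rightarrow> real^'n \<Rightarrow> real) \<Rightarrow> bool" where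
  "orientation A ori \<longleftrightarrow>
     (\<forall>c\<in>A. continuous_on (coord c ` cdom c) (ori c) \<and> ori c ` (coord c ` cdom c) \<subseteq> {1, -1}) \<and>
     (\<forall>c\<in>A. \<forall>d\<in>A. \<forall>p \<in> cdom c \<inter> cdom d.
        ori c (coord c p) = sgn (det (jacobian (transition c d) (at (coord c p)))) * ori d (coord d p))"


section \<open>Levi-Civita connection and curvature in a chart\<close>

text \<open>From here on, \<open>g\<close> is the component matrix of the metric in one chart. Components of tensor
  fields take the coordinate value followed by the indices from left to right, whether
  upper or lower.\<close>

definition ginv :: "(real^'n \<Rightarrow> real^'n^'n) \<Rightarrow> real^'n \<Rightarrow> 'n::finite \<Rightarrow> 'n \<Rightarrow> real" where
  "ginv g x i j = matrix_inv (g x) $ i $ j"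

text \<open>\<open>christoffel g x k i j\<close> is $\Gamma^k_{ij}$.\<close>

definition christoffel :: "(real^'n \<Rightarrow> real^'n^'n) \<Rightarrow> real^'n \<Rightarrow> 'n::finite \<Rightarrow> 'n \<Rightarrow> 'n \<Rightarrow> real" where
  "christoffel g x k i j =
     1/2 * (\<Sum>l\<in>UNIV. ginv g x k l *
       (pd i (\<lambda>y. g y $ j $ l) x + pd j (\<lambda>y. g y $ i $ l) x - pd l (\<lambda>y. g y $ i $ j) x))"

lemma pd_cong_open:
  assumes "open S" "x \<in> S" "\<And>y. y \<in> S \<Longrightarrow> f y = h y"
  shows "pd i f x = pd i h x"
proof -
  have "(f has_derivative D) (at x) \<longleftrightarrow> (h has_derivative D) (at x)" for D
    using has_derivative_transform_within_open[of f D x UNIV S h]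
      has_derivative_transform_within_open[of h D x UNIV S f] assms by auto
  then show ?thesis by (simp add: pd_def frechet_derivative_def)
qed

lemma sum_delta_matrix:
  fixes M N :: "real^'n::finite^'n"
  assumes "M ** N = mat 1"
  shows "(\<Sum>l\<in>UNIV. M $ k $ l * (\<Sum>m\<in>UNIV. N $ l $ m * v m)) = v k"
proof -
  have "(\<Sum>l\<in>UNIV. M $ k $ l * (\<Sum>m\<in>UNIV. N $ l $ m * v m)) = (M *v (N *v (\<chi> m. v m))) $ k"
    by (simp add: matrix_vector_mult_def)
  also have "\<dots> = v k"
    by (simp add: matrix_vector_mul_assoc assms)
  finally show ?thesis .
qed

text \<open>These coefficients are the ones of the Levi-Civita connection: the unique torsion-free
  connection for which the metric is parallel.\<close>

lemma levi_civita_iff_christoffel: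
  fixes g :: "real^'n::finite \<Rightarrow> real^'n^'n" and \<Gamma> :: "'n \<Rightarrow> 'n \<Rightarrow> 'n \<Rightarrow> real"
  assumes S: "open S" "x \<in> S" and sym: "\<And>y. y \<in> S \<Longrightarrow> transpose (g y) = g y"
    and inv: "invertible (g x)"
  shows "(\<forall>k i j. \<Gamma> k i j = \<Gamma> k j i) \<and>
     (\<forall>i j l. pd i (\<lambda>y. g y $ j $ l) x
        - (\<Sum>m\<in>UNIV. \<Gamma> m i j * g x $ m $ l) - (\<Sum>m\<in>UNIV. \<Gamma> m i l * g x $ j $ m) = 0)
     \<longleftrightarrow> (\<forall>k i j. \<Gamma> k i j = christoffel g x k i j)"
proof -
  have gs: "g y $ a $ b = g y $ b $ a" if "y \<in> S" for y a b
    using sym[OF that] by (metis transpose_def vec_lambda_beta)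
  define dg where "dg i j l = pd i (\<lambda>y. g y $ j $ l) x" for i j l
  have ds: "dg i j l = dg i l j" for i j l
    unfolding dg_def by (rule pd_cong_open[OF S]) (simp add: gs)
  define low where "low l i j = (\<Sum>m\<in>UNIV. g x $ l $ m * \<Gamma> m i j)" for l i j
  have mi: "g x ** matrix_inv (g x) = mat 1" "matrix_inv (g x) ** g x = mat 1"
    using inv someI_ex[of "\<lambda>B. g x ** B = mat 1 \<and> B ** g x = mat 1"]
    unfolding invertible_def matrix_inv_def by auto
  have ch: "christoffel g x k i j = (\<Sum>l\<in>UNIV. matrix_inv (g x) $ k $ l *
      ((dg i j l + dg j i l - dg l i j) / 2))" for k i j
    by (simp add: christoffel_def ginv_def dg_def sum_distrib_left field_simps)
  have up: "\<Gamma> k i j = (\<Sum>l\<in>UNIV. matrix_inv (g x) $ k $ l * low l i j)" for k i j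
    unfolding low_def by (rule sum_delta_matrix[OF mi(2), symmetric])
  have lowch: "(\<Sum>m\<in>UNIV. g x $ l $ m * christoffel g x m i j)
      = (dg i j l + dg j i l - dg l i j) / 2" for l i j
    unfolding ch by (rule sum_delta_matrix[OF mi(1)])
  have s1: "(\<Sum>m\<in>UNIV. \<Gamma> m i j * g x $ m $ l) = low l i j" for i j l
    unfolding low_def by (rule sum.cong) (simp_all add: gs[OF S(2), of l] mult.commute)
  have s2: "(\<Sum>m\<in>UNIV. \<Gamma> m i l * g x $ j $ m) = low j i l" for i j l
    unfolding low_def by (simp add: mult.commute)
  show ?thesis (is "?L \<longleftrightarrow> ?R")
  proof
    assume L: ?L
    have lsym: "low l i j = low l j i" for l i j
      unfolding low_def using L by (metis (no_types, lifting))
    have comp: "dg i j l = low l i j + low j i l" for i j l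
    proof -
      have "dg i j l - low l i j - low j i l = 0"
        using L unfolding dg_def s1 s2 by blast
      then show ?thesis by simp
    qed
    have lw: "low l i j = (dg i j l + dg j i l - dg l i j) / 2" for l i j
      using comp[of i j l] comp[of j i l] comp[of l i j] lsym[of l i j] lsym[of j i l] lsym[of i j l]
      by simp
    show ?R unfolding up ch lw by blast
  next
    assume R: ?R
    have l: "low l i j = (dg i j l + dg j i l - dg l i j) / 2" for l i j
      unfolding low_def using R lowch by simp
    have "\<Gamma> k i j = \<Gamma> k j i" for k i j
      using up[of k i j] up[of k j i] by (simp add: l ds[of _ i j] add.commute)
    moreover have "dg i j l - low l i j - low j i l = 0" for i j l
      unfolding l using ds[of i j l] ds[of j i l] ds[of l i j] by (simp add: field_simps)
    ultimately show ?L using s1 s2 unfolding dg_def by simp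
  qed
qed

text \<open>$\nabla_i X^k$, $\nabla_i T_j{}^k$ and $\nabla_i S_{jk}$.\<close>

definition nabla_vec ::
    "(real^'n \<Rightarrow> real^'n^'n) \<Rightarrow> (real^'n \<Rightarrow> 'n \<Rightarrow> real) \<Rightarrow> real^'n \<Rightarrow> 'n::finite \<Rightarrow> 'n \<Rightarrow> real" where
  "nabla_vec g X x i k =
     pd i (\<lambda>y. X y k) x + (\<Sum>m\<in>UNIV. christoffel g x k i m * X x m)"

definition nabla_mixed ::
    "(real^'n \<Rightarrow> real^'n^'n) \<Rightarrow> (real^'n \<Rightarrow> 'n \<Rightarrow> 'n \<Rightarrow> real)
      \<Rightarrow> real^'n \<Rightarrow> 'n::finite \<Rightarrow> 'n \<Rightarrow> 'n \<Rightarrow> real" where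
  "nabla_mixed g T x i j k =
     pd i (\<lambda>y. T y j k) x - (\<Sum>m\<in>UNIV. christoffel g x m i j * T x m k)
       + (\<Sum>m\<in>UNIV. christoffel g x k i m * T x j m)"

definition nabla_cov2 ::
    "(real^'n \<Rightarrow> real^'n^'n) \<Rightarrow> (real^'n \<Rightarrow> 'n \<Rightarrow> 'n \<Rightarrow> real)
      \<Rightarrow> real^'n \<Rightarrow> 'n::finite \<Rightarrow> 'n \<Rightarrow> 'n \<Rightarrow> real" where
  "nabla_cov2 g S x i j k =
     pd i (\<lambda>y. S y j k) x - (\<Sum>m\<in>UNIV. christoffel g x m i j * S x m k)
       - (\<Sum>m\<in>UNIV. christoffel g x m i k * S x j m)"

text \<open>\<open>riemann_up g x i j k l\<close> is $R_{ij}{}^k{}_l$, read off from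
  $R_{ij}{}^k{}_l X^l = \nabla_i \nabla_j X^k - \nabla_j \nabla_i X^k$
  with \<open>X\<close> the \<open>l\<close>-th coordinate vector field.\<close>

definition riemann_up ::
    "(real^'n \<Rightarrow> real^'n^'n) \<Rightarrow> real^'n \<Rightarrow> 'n::finite \<Rightarrow> 'n \<Rightarrow> 'n \<Rightarrow> 'n \<Rightarrow> real" where
  "riemann_up g x i j k l =
     (let X = (\<lambda>_ m. if m = l then 1 else 0)
      in nabla_mixed g (nabla_vec g X) x i j k - nabla_mixed g (nabla_vec g X) x j i k)"

definition riemann ::
    "(real^'n \<Rightarrow> real^'n^'n) \<Rightarrow> real^'n \<Rightarrow> 'n::finite \<Rightarrow> 'n \<Rightarrow> 'n \<Rightarrow> 'n \<Rightarrow> real" where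
  "riemann g x i j k l = (\<Sum>m\<in>UNIV. g x $ k $ m * riemann_up g x i j m l)"

definition ricci :: "(real^'n \<Rightarrow> real^'n^'n) \<Rightarrow> real^'n \<Rightarrow> 'n::finite \<Rightarrow> 'n \<Rightarrow> real" where
  "ricci g x i j = (\<Sum>k\<in>UNIV. riemann_up g x k i k j)"

definition scalar_curv :: "(real^'n \<Rightarrow> real^'n^'n) \<Rightarrow> real^'n::finite \<Rightarrow> real" where
  "scalar_curv g x = (\<Sum>i\<in>UNIV. \<Sum>j\<in>UNIV. ginv g x i j * ricci g x i j)"

definition schouten_J :: "(real^'n \<Rightarrow> real^'n^'n) \<Rightarrow> real^'n::finite \<Rightarrow> real" where
  "schouten_J g x = scalar_curv g x / (2 * (real CARD('n) - 1))"

definition schouten :: "(real^'n \<Rightarrow> real^'n^'n) \<Rightarrow> real^'n \<Rightarrow> 'n::finite \<Rightarrow> 'n \<Rightarrow> real" where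
  "schouten g x i j =
     1 / (real CARD('n) - 2) * (ricci g x i j - schouten_J g x * g x $ i $ j)"

definition weyl ::
    "(real^'n \<Rightarrow> real^'n^'n) \<Rightarrow> real^'n \<Rightarrow> 'n::finite \<Rightarrow> 'n \<Rightarrow> 'n \<Rightarrow> 'n \<Rightarrow> real" where
  "weyl g x i j k l = riemann g x i j k l -
     (schouten g x i k * g x $ j $ l - schouten g x i l * g x $ j $ k
      + schouten g x j l * g x $ i $ k - schouten g x j k * g x $ i $ l)"

definition cotton ::
    "(real^'n \<Rightarrow> real^'n^'n) \<Rightarrow> real^'n \<Rightarrow> 'n::finite \<Rightarrow> 'n \<Rightarrow> 'n \<Rightarrow> real" where
  "cotton g x i j k = nabla_cov2 g (schouten g) x i j k - nabla_cov2 g (schouten g) x j i k"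

text \<open>The index positions used below:
  $W_{ij}{}^{kl}$, $W_i{}^j{}_{kl}$, $C_{ij}{}^k$ and $C_i{}^j{}_k$.\<close>

definition weyl_dduu ::
    "(real^'n \<Rightarrow> real^'n^'n) \<Rightarrow> real^'n \<Rightarrow> 'n::finite \<Rightarrow> 'n \<Rightarrow> 'n \<Rightarrow> 'n \<Rightarrow> real" where
  "weyl_dduu g x i j k l =
     (\<Sum>a\<in>UNIV. \<Sum>b\<in>UNIV. ginv g x k a * ginv g x l b * weyl g x i j a b)"

definition weyl_dudd ::
    "(real^'n \<Rightarrow> real^'n^'n) \<Rightarrow> real^'n \<Rightarrow> 'n::finite \<Rightarrow> 'n \<Rightarrow> 'n \<Rightarrow> 'n \<Rightarrow> real" where
  "weyl_dudd g x i j k l = (\<Sum>a\<in>UNIV. ginv g x j a * weyl g x i a k l)"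

definition cotton_ddu ::
    "(real^'n \<Rightarrow> real^'n^'n) \<Rightarrow> real^'n \<Rightarrow> 'n::finite \<Rightarrow> 'n \<Rightarrow> 'n \<Rightarrow> real" where
  "cotton_ddu g x i j k = (\<Sum>a\<in>UNIV. ginv g x k a * cotton g x i j a)"

definition cotton_dud ::
    "(real^'n \<Rightarrow> real^'n^'n) \<Rightarrow> real^'n \<Rightarrow> 'n::finite \<Rightarrow> 'n \<Rightarrow> 'n \<Rightarrow> real" where
  "cotton_dud g x i j k = (\<Sum>a\<in>UNIV. ginv g x j a * cotton g x i a k)"


section \<open>Multi-indices and the generalized Kronecker delta\<close>

text \<open>A multi-index $i_1 \cdots i_m$ is a function \<open>I\<close> on \<open>{1..m}\<close>. Contraction is summation over
  \<open>multi m\<close>, or over \<open>multi1 m i\<close> if the first index is the free index \<open>i\<close>.\<close>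

definition multi :: "nat \<Rightarrow> (nat \<Rightarrow> 'n) set" where
  "multi m = {1..m} \<rightarrow>\<^sub>E UNIV"

definition multi1 :: "nat \<Rightarrow> 'n \<Rightarrow> (nat \<Rightarrow> 'n) set" where
  "multi1 m i = {I \<in> multi m. I 1 = i}"

text \<open>\<open>I\<close> holds the lower indices, \<open>J\<close> the upper ones.\<close>

definition gdelta :: "nat \<Rightarrow> (nat \<Rightarrow> 'n) \<Rightarrow> (nat \<Rightarrow> 'n) \<Rightarrow> real" where
  "gdelta m I J =
     (\<Sum>\<sigma> | \<sigma> permutes {1..m}. of_int (sign \<sigma>) * (\<Prod>a\<in>{1..m}. if I a = J (\<sigma> a) then 1 else 0))"


section \<open>The Pfaffian and the one-form \<open>\<xi>\<close>\<close>

definition Pf :: "nat \<Rightarrow> (real^'n \<Rightarrow> real^'n^'n) \<Rightarrow> real^'n::finite \<Rightarrow> real" where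
  "Pf k g x = 1 / fact k *
     (\<Sum>I\<in>multi (2*k). \<Sum>J\<in>multi (2*k). gdelta (2*k) I J *
        (\<Prod>a\<in>{1..k}. weyl_dduu g x (J (2*a-1)) (J (2*a)) (I (2*a-1)) (I (2*a))))"

definition xi :: "nat \<Rightarrow> (real^'n \<Rightarrow> real^'n^'n) \<Rightarrow> real^'n \<Rightarrow> 'n::finite \<Rightarrow> real" where
  "xi k g x i = 1 / fact k *
     (\<Sum>I\<in>multi1 (2*k) i. \<Sum>J\<in>multi (2*k). gdelta (2*k) I J *
        cotton_ddu g x (J 1) (J 2) (I 2) *
        (\<Prod>a\<in>{2..k}. weyl_dduu g x (J (2*a-1)) (J (2*a)) (I (2*a-1)) (I (2*a))))
     + 1 / (2 * real CARD('n) * real k) * pd i (Pf k g) x"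


section \<open>Invariant polynomials and the one-form \<open>\<rho>\<close>\<close>

text \<open>\<open>\<Phi> I J\<close> is $\Phi_{i_1\cdots i_k}^{j_1\cdots j_k}$. It has constant components, the same in all
  frames.\<close>

definition homogeneous_invariant_polynomial ::
    "nat \<Rightarrow> ((nat \<Rightarrow> 'n) \<Rightarrow> (nat \<Rightarrow> 'n) \<Rightarrow> real) \<Rightarrow> bool" where
  "homogeneous_invariant_polynomial k \<Phi> \<longleftrightarrow>
     (\<exists>c :: (nat \<Rightarrow> nat) \<Rightarrow> real. \<forall>I J.
        \<Phi> I J = (\<Sum>\<pi> | \<pi> permutes {1..k}. c \<pi> * (\<Prod>a\<in>{1..k}. if I a = J (\<pi> a) then 1 else 0))) \<and>
     (\<forall>\<sigma>. \<sigma> permutes {1..k} \<longrightarrow> (\<forall>I J. \<Phi> I J = \<Phi> (I \<circ> \<sigma>) (J \<circ> \<sigma>)))"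

text \<open>A fixed enumeration of the coordinates by \<open>{1..CARD('n)}\<close>. Another enumeration at most
  exchanges the two orientations.\<close>

definition frame_index :: "nat \<Rightarrow> 'n::finite" where
  "frame_index a = from_nat_into UNIV (a - 1)"

text \<open>The volume form $\epsilon_{i_1\cdots i_n}$ with all indices down, with all indices up, and with
  only the first index down. The argument \<open>s\<close> is the orientation sign of the coordinate frame.\<close>

definition vol ::
    "(real^'n \<Rightarrow> real) \<Rightarrow> (real^'n \<Rightarrow> real^'n^'n) \<Rightarrow> real^'n \<Rightarrow> (nat \<Rightarrow> 'n::finite) \<Rightarrow> real" where
  "vol s g x I = s x * sqrt \<bar>det (g x)\<bar> * gdelta CARD('n) I frame_index"

definition vol_up ::
    "(real^'n \<Rightarrow> real) \<Rightarrow> (real^'n \<Rightarrow> real^'n^'n) \<Rightarrow> real^'n \<Rightarrow> (nat \<Rightarrow> 'n::finite) \<Rightarrow> real" where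
  "vol_up s g x I =
     (\<Sum>L\<in>multi CARD('n). vol s g x L * (\<Prod>a\<in>{1..CARD('n)}. ginv g x (I a) (L a)))"

definition vol_mixed ::
    "(real^'n \<Rightarrow> real) \<Rightarrow> (real^'n \<Rightarrow> real^'n^'n) \<Rightarrow> real^'n \<Rightarrow> (nat \<Rightarrow> 'n::finite) \<Rightarrow> real" where
  "vol_mixed s g x I =
     (\<Sum>L\<in>multi1 CARD('n) (I 1). vol s g x L * (\<Prod>a\<in>{2..CARD('n)}. ginv g x (I a) (L a)))"

definition p_poly ::
    "nat \<Rightarrow> ((nat \<Rightarrow> 'n) \<Rightarrow> (nat \<Rightarrow> 'n) \<Rightarrow> real) \<Rightarrow> (real^'n \<Rightarrow> real)
      \<Rightarrow> (real^'n \<Rightarrow> real^'n^'n) \<Rightarrow> real^'n::finite \<Rightarrow> real" where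
  "p_poly k \<Phi> s g x = 1 / fact (2*k) *
     (\<Sum>I\<in>multi (2*k). \<Sum>S\<in>multi k. \<Sum>T\<in>multi k. vol_up s g x I * \<Phi> S T *
        (\<Prod>a\<in>{1..k}. weyl_dudd g x (T a) (S a) (I (2*a-1)) (I (2*a))))"

definition rho ::
    "nat \<Rightarrow> ((nat \<Rightarrow> 'n) \<Rightarrow> (nat \<Rightarrow> 'n) \<Rightarrow> real) \<Rightarrow> (real^'n \<Rightarrow> real)
      \<Rightarrow> (real^'n \<Rightarrow> real^'n^'n) \<Rightarrow> real^'n \<Rightarrow> 'n::finite \<Rightarrow> real" where
  "rho k \<Phi> s g x i = 1 / fact (2*k-1) *
     (\<Sum>I\<in>multi1 (2*k) i. \<Sum>S\<in>multi k. \<Sum>T\<in>multi k. vol_mixed s g x I * \<Phi> S T *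
        cotton_dud g x (T 1) (S 1) (I 2) *
        (\<Prod>a\<in>{2..k}. weyl_dudd g x (T a) (S a) (I (2*a-1)) (I (2*a))))
     + 1 / (2 * real k) * pd i (p_poly k \<Phi> s g) x"

end

theory Submission
  imports Defs
begin

text \<open>
  Write $\hat g = e^{2u} g$ in a chart. The Christoffel symbols change by
  $D^k_{ij} = \delta^k_i \nabla_j u + \delta^k_j \nabla_i u - g_{ij} \nabla^k u$. Inserting this into
  the curvature (\<open>riemann_gh\<close>) shows that the Schouten tensor changes by
  $A_{ij} = - \nabla_i \nabla_j u + \nabla_i u \nabla_j u - \frac12 |\nabla u|^2 g_{ij}$ and that
  $\hat W_{ijkl} = e^{2u} W_{ijkl}$ (\<open>schouten_gh\<close>, \<open>weyl_gh\<close>). By the Ricci identity for $\nabla u$,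
  the Cotton tensor changes by a Weyl term, $\hat C_{ijk} = C_{ijk} + W_{ijlk} \nabla^l u$
  (\<open>cotton_gh\<close>).

  Consequently the first summand of $\xi_i$, multiplied by $e^{2ku}$, changes by
  $\frac1{k!} \delta_{i i_2 \cdots}^{j_1 j_2 \cdots} W_{j_1 j_2}{}^{l i_2} W_{j_3 j_4}{}^{i_3 i_4} \cdots
  \nabla_l u$. This is the contraction of $\nabla_l u$ with the endomorphism obtained from the full
  contraction in the Pfaffian by leaving the first position free. Since the
  dimension is $n = 2k$, alternating over $n + 1$ indices gives zero
  (\<open>alternating_exchange\<close>), and together with the symmetry of the contraction under exchanging
  pairs of positions and swapping the positions within a pair, this makes the endomorphism a multiple of the identity
  (\<open>contraction_eq_trace\<close>). The change is therefore $\frac1n \mathrm{Pf}(W) \nabla_i u$. As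
  $\mathrm{Pf}(\hat W) = e^{-2ku} \mathrm{Pf}(W)$, the gradient term of $\xi_i$ changes by
  $- \frac1n \mathrm{Pf}(W) \nabla_i u$, and the two changes cancel (\<open>xi_gh\<close>).

  The argument for $\rho_i$ is the same (\<open>rho_gh\<close>), with the volume form in place of the generalized
  Kronecker delta. The symmetry of \<open>\<Phi>\<close> under simultaneous permutations makes the contraction
  symmetric under exchange of pairs.
\<close>

section \<open>Calculus of smooth functions\<close>

lemma pd_eqI: "(f has_derivative D) (at x) \<Longrightarrow> pd i f x = D (axis i 1)"
  unfolding pd_def using frechet_derivative_at by metis

lemma has_derivative_pd:
  "f differentiable (at x) \<Longrightarrow> (f has_derivative frechet_derivative f (at x)) (at x)"
  by (simp add: frechet_derivative_works)

lemma pd_const [simp]: "pd i (\<lambda>_. c) x = 0"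
  by (rule pd_eqI[of _ "\<lambda>_. 0"]) simp

lemma pd_add:
  assumes "f differentiable (at x)" "h differentiable (at x)"
  shows "pd i (\<lambda>y. f y + h y) x = pd i f x + pd i h x"
  using pd_eqI[OF has_derivative_add[OF has_derivative_pd[OF assms(1)] has_derivative_pd[OF assms(2)]]]
  by (simp add: pd_def)

lemma pd_minus:
  assumes "f differentiable (at x)"
  shows "pd i (\<lambda>y. - f y) x = - pd i f x"
  using pd_eqI[OF has_derivative_minus[OF has_derivative_pd[OF assms(1)]]]
  by (simp add: pd_def)

lemma pd_diff:
  assumes "f differentiable (at x)" "h differentiable (at x)"
  shows "pd i (\<lambda>y. f y - h y) x = pd i f x - pd i h x"
  using pd_eqI[OF has_derivative_diff[OF has_derivative_pd[OF assms(1)] has_derivative_pd[OF assms(2)]]]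
  by (simp add: pd_def)

lemma pd_mult:
  assumes "f differentiable (at x)" "h differentiable (at x)"
  shows "pd i (\<lambda>y. f y * h y) x = pd i f x * h x + f x * pd i h x"
  using pd_eqI[OF has_derivative_mult[OF has_derivative_pd[OF assms(1)] has_derivative_pd[OF assms(2)]]]
  by (simp add: pd_def)

lemma pd_sum:
  assumes "\<And>a. a \<in> A \<Longrightarrow> f a differentiable (at x)"
  shows "pd i (\<lambda>y. \<Sum>a\<in>A. f a y) x = (\<Sum>a\<in>A. pd i (f a) x)"
  using pd_eqI[OF has_derivative_sum[of A f "\<lambda>a. frechet_derivative (f a) (at x)"]] assms
  by (simp add: pd_def frechet_derivative_works)

lemma has_derivative_exp_mult:
  fixes f :: "real^'n::finite \<Rightarrow> real"
  assumes "f differentiable (at x)"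
  shows "((\<lambda>y. exp (c * f y)) has_derivative
    (\<lambda>v. exp (c * f x) * (c * frechet_derivative f (at x) v))) (at x)"
proof -
  have "((\<lambda>y. c * f y) has_derivative (\<lambda>v. c * frechet_derivative f (at x) v)) (at x)"
    by (intro has_derivative_mult_right has_derivative_pd assms)
  moreover have "(exp has_derivative (\<lambda>v. exp (c * f x) * v)) (at (c * f x))"
    using DERIV_exp[of "c * f x"] by (simp add: has_field_derivative_def)
  ultimately show ?thesis
    using has_derivative_compose by fastforce
qed

lemma pd_exp_mult:
  assumes "f differentiable (at x)"
  shows "pd i (\<lambda>y. exp (c * f y)) x = c * pd i f x * exp (c * f x)"
  by (subst pd_eqI[OF has_derivative_exp_mult[OF assms]]) (simp add: pd_def)

lemma differentiable_on_open_cong: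
  assumes "open S" "\<And>x. x \<in> S \<Longrightarrow> f x = h x" "f differentiable_on S"
  shows "h differentiable_on S"
  using assms has_derivative_transform_within_open[of f _ _ UNIV S h]
  unfolding differentiable_on_eq_differentiable_at[OF assms(1)] differentiable_def by metis

lemma Ck_on_cong:
  assumes "open S" "\<And>x. x \<in> S \<Longrightarrow> f x = h x"
  shows "Ck_on r S f \<Longrightarrow> Ck_on r S h"
  using assms(2)
proof (induction r arbitrary: f h)
  case 0
  then show ?case by (metis Ck_on.simps(1) continuous_on_cong)
next
  case (Suc r)
  have "pd i f x = pd i h x" if "x \<in> S" for i x
    using pd_cong_open[OF assms(1) that] Suc.prems(2) by blast
  then have "Ck_on r S (pd i h)" for i
    using Suc.IH[of "pd i f" "pd i h"] Suc.prems(1) by simp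
  moreover have "h differentiable_on S"
    using differentiable_on_open_cong[OF assms(1) Suc.prems(2)] Suc.prems(1) by simp
  ultimately show ?case by simp
qed

lemma Ck_on_Suc_imp: "Ck_on (Suc r) S f \<Longrightarrow> Ck_on r S f"
proof (induction r arbitrary: f)
  case 0
  then show ?case by (simp add: differentiable_imp_continuous_on)
next
  case (Suc r)
  then show ?case by (metis Ck_on.simps(2))
qed

lemma differentiable_on_at:
  "open S \<Longrightarrow> x \<in> S \<Longrightarrow> f differentiable_on S \<Longrightarrow> f differentiable (at x)"
  by (simp add: differentiable_on_eq_differentiable_at)

lemma Ck_on_const:
  fixes S :: "(real^'n::finite) set"
  shows "Ck_on r S (\<lambda>_. c)"
proof (induction r arbitrary: c)
  case 0
  then show ?case by simp
next
  case (Suc r)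
  have "pd i (\<lambda>_. c) = (\<lambda>_. 0)" for i :: 'n
    by (rule ext) simp
  then show ?case using Suc by simp
qed

lemma Ck_on_add:
  assumes "open S"
  shows "Ck_on r S f \<Longrightarrow> Ck_on r S h \<Longrightarrow> Ck_on r S (\<lambda>x. f x + h x)"
proof (induction r arbitrary: f h)
  case 0
  then show ?case by (simp add: continuous_on_add)
next
  case (Suc r)
  have d: "f differentiable_on S" "h differentiable_on S" using Suc.prems by auto
  have "Ck_on r S (pd i (\<lambda>x. f x + h x))" for i
  proof (rule Ck_on_cong[OF assms])
    show "Ck_on r S (\<lambda>x. pd i f x + pd i h x)" using Suc by simp
    show "pd i f x + pd i h x = pd i (\<lambda>x. f x + h x) x" if "x \<in> S" for x
      using d[THEN differentiable_on_at[OF assms that]] by (simp add: pd_add)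
  qed
  then show ?case using d by simp
qed

lemma Ck_on_mult:
  assumes "open S"
  shows "Ck_on r S f \<Longrightarrow> Ck_on r S h \<Longrightarrow> Ck_on r S (\<lambda>x. f x * h x)"
proof (induction r arbitrary: f h)
  case 0
  then show ?case by (simp add: continuous_on_mult)
next
  case (Suc r)
  have d: "f differentiable_on S" "h differentiable_on S" using Suc.prems by auto
  have "Ck_on r S (pd i (\<lambda>x. f x * h x))" for i
  proof (rule Ck_on_cong[OF assms])
    show "Ck_on r S (\<lambda>x. pd i f x * h x + f x * pd i h x)"
      using Suc.prems Suc.prems[THEN Ck_on_Suc_imp] by (intro Ck_on_add[OF assms] Suc.IH) auto
    show "pd i f x * h x + f x * pd i h x = pd i (\<lambda>x. f x * h x) x" if "x \<in> S" for x
      using d[THEN differentiable_on_at[OF assms that]] by (simp add: pd_mult)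
  qed
  moreover have "(\<lambda>x. f x * h x) differentiable_on S"
    using d by (simp add: differentiable_on_def differentiable_mult)
  ultimately show ?case by simp
qed

lemma Ck_on_inverse:
  assumes "open S" "\<And>x. x \<in> S \<Longrightarrow> f x \<noteq> 0"
  shows "Ck_on r S f \<Longrightarrow> Ck_on r S (\<lambda>x. inverse (f x))"
proof (induction r)
  case 0
  then show ?case using assms by (simp add: continuous_on_inverse)
next
  case (Suc r)
  have d: "f differentiable_on S" using Suc.prems by auto
  have D: "((\<lambda>x. inverse (f x)) has_derivative
      (\<lambda>v. - (inverse (f x) * frechet_derivative f (at x) v * inverse (f x)))) (at x)"
    if "x \<in> S" for x
    using that by (intro Deriv.has_derivative_inverse assms(2) has_derivative_pd
        differentiable_on_at[OF assms(1) _ d])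
  have "Ck_on r S (pd i (\<lambda>x. inverse (f x)))" for i
  proof (rule Ck_on_cong[OF assms(1)])
    show "Ck_on r S (\<lambda>x. (-1) * (inverse (f x) * pd i f x * inverse (f x)))"
      using Suc Ck_on_Suc_imp[of r S f] by (intro Ck_on_mult[OF assms(1)] Ck_on_const) auto
    show "(-1) * (inverse (f x) * pd i f x * inverse (f x)) = pd i (\<lambda>x. inverse (f x)) x"
      if "x \<in> S" for x
      by (subst pd_eqI[OF D[OF that]]) (simp add: pd_def)
  qed
  moreover have "(\<lambda>x. inverse (f x)) differentiable_on S"
    using D differentiable_def
    by (auto simp: differentiable_on_eq_differentiable_at[OF assms(1)])
  ultimately show ?case by simp
qed

text \<open>Rules that reduce smoothness of a compound function to smoothness of its parts.\<close>

named_theorems smooth_intros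

lemma smooth_on_cong:
  "open S \<Longrightarrow> (\<And>x. x \<in> S \<Longrightarrow> f x = h x) \<Longrightarrow> smooth_on S f \<Longrightarrow> smooth_on S h"
  unfolding smooth_on_def using Ck_on_cong by blast

lemma smooth_on_const [smooth_intros]: "smooth_on S (\<lambda>_. c)"
  by (simp add: smooth_on_def Ck_on_const)

lemma smooth_on_add [smooth_intros]:
  "open S \<Longrightarrow> smooth_on S f \<Longrightarrow> smooth_on S h \<Longrightarrow> smooth_on S (\<lambda>x. f x + h x)"
  by (simp add: smooth_on_def Ck_on_add)

lemma smooth_on_mult [smooth_intros]:
  "open S \<Longrightarrow> smooth_on S f \<Longrightarrow> smooth_on S h \<Longrightarrow> smooth_on S (\<lambda>x. f x * h x)"
  by (simp add: smooth_on_def Ck_on_mult)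

lemma smooth_on_inverse:
  "open S \<Longrightarrow> (\<And>x. x \<in> S \<Longrightarrow> f x \<noteq> 0) \<Longrightarrow> smooth_on S f \<Longrightarrow> smooth_on S (\<lambda>x. inverse (f x))"
  by (simp add: smooth_on_def Ck_on_inverse)

lemma smooth_on_minus [smooth_intros]:
  "open S \<Longrightarrow> smooth_on S f \<Longrightarrow> smooth_on S (\<lambda>x. - f x)"
  using smooth_on_mult[of S "\<lambda>_. -1" f] by (simp add: smooth_on_const)

lemma smooth_on_diff [smooth_intros]:
  "open S \<Longrightarrow> smooth_on S f \<Longrightarrow> smooth_on S h \<Longrightarrow> smooth_on S (\<lambda>x. f x - h x)"
  using smooth_on_add[of S f "\<lambda>x. - h x"] by (simp add: smooth_on_minus)

lemma smooth_on_sum [smooth_intros]: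
  "open S \<Longrightarrow> (\<And>a. a \<in> A \<Longrightarrow> smooth_on S (f a)) \<Longrightarrow> smooth_on S (\<lambda>x. \<Sum>a\<in>A. f a x)"
  by (induction A rule: infinite_finite_induct) (simp_all add: smooth_on_const smooth_on_add)

lemma smooth_on_prod [smooth_intros]:
  "open S \<Longrightarrow> (\<And>a. a \<in> A \<Longrightarrow> smooth_on S (f a)) \<Longrightarrow> smooth_on S (\<lambda>x. \<Prod>a\<in>A. f a x)"
  by (induction A rule: infinite_finite_induct) (simp_all add: smooth_on_const smooth_on_mult)

lemma smooth_on_pd [smooth_intros]: "smooth_on S f \<Longrightarrow> smooth_on S (pd i f)"
  unfolding smooth_on_def using Ck_on.simps(2) by blast

lemma smooth_on_differentiable:
  "open S \<Longrightarrow> x \<in> S \<Longrightarrow> smooth_on S f \<Longrightarrow> f differentiable (at x)"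
  unfolding smooth_on_def by (metis Ck_on.simps(2) differentiable_on_at)

lemma smooth_on_continuous: "smooth_on S f \<Longrightarrow> continuous_on S f"
  unfolding smooth_on_def by (metis Ck_on.simps(1))

lemma has_real_derivative_along_axis:
  assumes "f differentiable (at (y + t *\<^sub>R axis i 1))"
  shows "((\<lambda>s. f (y + s *\<^sub>R axis i 1)) has_real_derivative pd i f (y + t *\<^sub>R axis i 1)) (at t)"
proof -
  let ?D = "frechet_derivative f (at (y + t *\<^sub>R axis i 1))"
  have "((\<lambda>s. y + s *\<^sub>R axis i 1) has_derivative (\<lambda>s. s *\<^sub>R axis i 1)) (at t)"
    by (auto intro!: derivative_eq_intros)
  then have "((\<lambda>s. f (y + s *\<^sub>R axis i 1)) has_derivative (\<lambda>s. ?D (s *\<^sub>R axis i 1))) (at t)"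
    using has_derivative_compose has_derivative_pd[OF assms] by blast
  moreover have "(\<lambda>s. ?D (s *\<^sub>R axis i 1)) = (*) (pd i f (y + t *\<^sub>R axis i 1))"
    using linear_scale[OF linear_frechet_derivative[OF assms]] by (auto simp: pd_def)
  ultimately show ?thesis
    unfolding has_field_derivative_def by simp
qed

text \<open>The second difference of a function over a square equals a mixed second derivative at some
  point of the square. It is symmetric in the two directions, which forces the mixed derivatives
  to agree.\<close>

lemma second_difference_mixed_pd:
  fixes x :: "real^'n::finite"
  assumes S: "open S" and f: "smooth_on S f" and h: "h > 0"
    and sub: "\<And>s t. 0 \<le> s \<Longrightarrow> s \<le> h \<Longrightarrow> 0 \<le> t \<Longrightarrow> t \<le> h \<Longrightarrow> x + s *\<^sub>R axis i 1 + t *\<^sub>R axis j 1 \<in> S"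
  shows "\<exists>s t. 0 < s \<and> s < h \<and> 0 < t \<and> t < h \<and>
    f (x + h *\<^sub>R axis i 1 + h *\<^sub>R axis j 1) - f (x + h *\<^sub>R axis i 1)
      - f (x + h *\<^sub>R axis j 1) + f x
      = h * h * pd j (pd i f) (x + s *\<^sub>R axis i 1 + t *\<^sub>R axis j 1)"
proof -
  let ?p = "\<lambda>s t. x + s *\<^sub>R axis i 1 + t *\<^sub>R axis j 1"
  define a where "a s = f (?p s h) - f (?p s 0)" for s
  have da: "(a has_real_derivative pd i f (?p s h) - pd i f (?p s 0)) (at s)"
    if "0 \<le> s" "s \<le> h" for s
  proof -
    have "((\<lambda>s. f (?p s t)) has_real_derivative pd i f (?p s t)) (at s)" if "0 \<le> t" "t \<le> h" for t
    proof -
      have "f differentiable (at (?p s t))"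
        using smooth_on_differentiable[OF S _ f] sub \<open>0 \<le> s\<close> \<open>s \<le> h\<close> that by blast
      then show ?thesis
        using has_real_derivative_along_axis[of f "x + t *\<^sub>R axis j 1" s i] by (simp add: add_ac)
    qed
    from DERIV_diff[OF this[of h] this[of 0]] show ?thesis
      using h unfolding a_def by simp
  qed
  obtain s where s: "0 < s" "s < h" "a h - a 0 = h * (pd i f (?p s h) - pd i f (?p s 0))"
    using MVT2[OF h da] by auto
  have "((\<lambda>t. pd i f (?p s t)) has_real_derivative pd j (pd i f) (?p s t)) (at t)"
    if "0 \<le> t" "t \<le> h" for t
  proof -
    have "pd i f differentiable (at (?p s t))"
      using smooth_on_differentiable[OF S _ smooth_on_pd[OF f]] sub s that by force
    then show ?thesis
      by (rule has_real_derivative_along_axis)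
  qed
  from MVT2[OF h this] obtain t where t: "0 < t" "t < h"
      "pd i f (?p s h) - pd i f (?p s 0) = h * pd j (pd i f) (?p s t)"
    by auto
  have "a h - a 0 = h * h * pd j (pd i f) (?p s t)"
    using s t by simp
  then show ?thesis
    using s t unfolding a_def by (intro exI[of _ s] exI[of _ t]) simp
qed

lemma pd_commute:
  fixes f :: "real^'n::finite \<Rightarrow> real"
  assumes S: "open S" "x \<in> S" and f: "smooth_on S f"
  shows "pd i (pd j f) x = pd j (pd i f) x"
proof (rule ccontr)
  assume ne: "\<not> ?thesis"
  define \<epsilon> where "\<epsilon> = \<bar>pd i (pd j f) x - pd j (pd i f) x\<bar> / 2"
  have \<epsilon>: "\<epsilon> > 0" using ne by (simp add: \<epsilon>_def)
  have cont: "isCont (pd i (pd j f)) x" "isCont (pd j (pd i f)) x"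
    using smooth_on_continuous[OF smooth_on_pd[OF smooth_on_pd[OF f]]] S
    by (auto simp: continuous_on_eq_continuous_at)
  obtain d1 where d1: "d1 > 0" "\<And>y. dist y x < d1 \<Longrightarrow> dist (pd i (pd j f) y) (pd i (pd j f) x) < \<epsilon>"
    using cont(1) \<epsilon> unfolding continuous_at_eps_delta by blast
  obtain d2 where d2: "d2 > 0" "\<And>y. dist y x < d2 \<Longrightarrow> dist (pd j (pd i f) y) (pd j (pd i f) x) < \<epsilon>"
    using cont(2) \<epsilon> unfolding continuous_at_eps_delta by blast
  obtain d3 where d3: "d3 > 0" "\<And>y. dist y x < d3 \<Longrightarrow> y \<in> S"
    using S by (meson open_dist)
  define h where "h = min d1 (min d2 d3) / 3"
  have h: "h > 0" "2 * h < d1" "2 * h < d2" "2 * h < d3"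
    using d1(1) d2(1) d3(1) by (auto simp: h_def min_def)
  have near: "dist (x + s *\<^sub>R axis a 1 + t *\<^sub>R axis b 1) x \<le> 2 * h"
    if "0 \<le> s" "s \<le> h" "0 \<le> t" "t \<le> h" for s t and a b :: 'n
  proof -
    have "dist (x + s *\<^sub>R axis a 1 + t *\<^sub>R axis b 1) x = norm (s *\<^sub>R axis a 1 + t *\<^sub>R axis b (1::real))"
      by (simp add: dist_norm)
    also have "\<dots> \<le> norm (s *\<^sub>R axis a (1::real)) + norm (t *\<^sub>R axis b (1::real))"
      by (rule norm_triangle_ineq)
    also have "\<dots> \<le> 2 * h"
      using that by simp
    finally show ?thesis .
  qed
  have sub: "x + s *\<^sub>R axis a 1 + t *\<^sub>R axis b 1 \<in> S"
    if "0 \<le> s" "s \<le> h" "0 \<le> t" "t \<le> h" for s t and a b :: 'n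
    using near[OF that, of a b] d3(2) h(4) by force
  define \<Delta> where "\<Delta> = f (x + h *\<^sub>R axis i 1 + h *\<^sub>R axis j 1) - f (x + h *\<^sub>R axis i 1)
      - f (x + h *\<^sub>R axis j 1) + f x"
  obtain s t where st: "0 < s" "s < h" "0 < t" "t < h"
      "\<Delta> = h * h * pd j (pd i f) (x + s *\<^sub>R axis i 1 + t *\<^sub>R axis j 1)"
    using second_difference_mixed_pd[OF S(1) f h(1) sub, of i j] unfolding \<Delta>_def by blast
  obtain s' t' where st': "0 < s'" "s' < h" "0 < t'" "t' < h"
      "f (x + h *\<^sub>R axis j 1 + h *\<^sub>R axis i 1) - f (x + h *\<^sub>R axis j 1) - f (x + h *\<^sub>R axis i 1) + f x
        = h * h * pd i (pd j f) (x + s' *\<^sub>R axis j 1 + t' *\<^sub>R axis i 1)"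
    using second_difference_mixed_pd[OF S(1) f h(1) sub, of j i] by blast
  let ?p = "x + s *\<^sub>R axis i 1 + t *\<^sub>R axis j 1" and ?q = "x + s' *\<^sub>R axis j 1 + t' *\<^sub>R axis i 1"
  have "\<Delta> = h * h * pd i (pd j f) ?q"
    using st'(5) unfolding \<Delta>_def by (simp add: add_ac diff_diff_eq)
  then have eq: "pd j (pd i f) ?p = pd i (pd j f) ?q"
    using st(5) h(1) by simp
  have "dist ?p x < d2" "dist ?q x < d1"
    using near[of s t i j] near[of s' t' j i] st st' h by auto
  then have "\<bar>pd j (pd i f) ?p - pd j (pd i f) x\<bar> < \<epsilon>" "\<bar>pd i (pd j f) ?q - pd i (pd j f) x\<bar> < \<epsilon>"
    using d1(2) d2(2) by (auto simp: dist_real_def)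
  then show False
    using eq unfolding \<epsilon>_def by (simp add: abs_if split: if_splits)
qed

section \<open>The Levi-Civita connection and the curvature of a metric in a chart\<close>

lemma sum_delta_mult [simp]:
  fixes f :: "'n::finite \<Rightarrow> real"
  shows "(\<Sum>m\<in>UNIV. (if m = a then 1 else 0) * f m) = f a"
    "(\<Sum>m\<in>UNIV. (if a = m then 1 else 0) * f m) = f a"
    "(\<Sum>m\<in>UNIV. f m * (if m = a then 1 else 0)) = f a"
    "(\<Sum>m\<in>UNIV. f m * (if a = m then 1 else 0)) = f a"
  by (simp_all add: if_distrib if_distribR cong: if_cong)

lemma matrix_inv_works:
  assumes "invertible (M :: real^'n::finite^'n)"
  shows "M ** matrix_inv M = mat 1" "matrix_inv M ** M = mat 1"
  using assms someI_ex[of "\<lambda>B. M ** B = mat 1 \<and> B ** M = mat 1"]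
  unfolding invertible_def matrix_inv_def by auto

lemma smooth_on_det:
  fixes M :: "real^'m::finite \<Rightarrow> real^'n::finite^'n"
  assumes "open S" "\<And>i j. smooth_on S (\<lambda>x. M x $ i $ j)"
  shows "smooth_on S (\<lambda>x. det (M x))"
  unfolding det_def using assms by (intro smooth_intros) auto

text \<open>A pseudo-Riemannian metric on the open set \<open>S\<close> of coordinate values of a chart.\<close>

locale metric_chart =
  fixes S :: "(real^'n::finite) set" and g :: "real^'n \<Rightarrow> real^'n^'n"
  assumes open_S: "open S"
    and smooth_g: "\<And>i j. smooth_on S (\<lambda>x. g x $ i $ j)"
    and transpose_g: "\<And>x. x \<in> S \<Longrightarrow> transpose (g x) = g x"
    and invertible_g: "\<And>x. x \<in> S \<Longrightarrow> invertible (g x)"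
begin

lemma g_sym: "x \<in> S \<Longrightarrow> g x $ i $ j = g x $ j $ i"
  using arg_cong[OF transpose_g, of x "\<lambda>M. M $ j $ i"] by (simp add: transpose_def)

lemma diff_at: "smooth_on S f \<Longrightarrow> x \<in> S \<Longrightarrow> f differentiable (at x)"
  using smooth_on_differentiable[OF open_S] by blast

lemma sum_g_ginv: "x \<in> S \<Longrightarrow> (\<Sum>m\<in>UNIV. g x $ i $ m * ginv g x m j) = (if i = j then 1 else 0)"
  using arg_cong[OF matrix_inv_works(1)[OF invertible_g], of x "\<lambda>M. M $ i $ j"]
  by (simp add: matrix_matrix_mult_def mat_def ginv_def)

lemma sum_ginv_g: "x \<in> S \<Longrightarrow> (\<Sum>m\<in>UNIV. ginv g x i m * g x $ m $ j) = (if i = j then 1 else 0)"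
  using arg_cong[OF matrix_inv_works(2)[OF invertible_g], of x "\<lambda>M. M $ i $ j"]
  by (simp add: matrix_matrix_mult_def mat_def ginv_def)

lemma ginv_sym:
  assumes x: "x \<in> S"
  shows "ginv g x i j = ginv g x j i"
proof -
  let ?M = "matrix_inv (g x)"
  note inv = matrix_inv_works[OF invertible_g[OF x]]
  have "transpose ?M ** g x = mat 1"
    using arg_cong[OF inv(1), of transpose]
    by (simp add: matrix_transpose_mul transpose_mat transpose_g[OF x])
  then have "?M = (transpose ?M ** g x) ** ?M"
    by (simp add: matrix_mul_lid)
  also have "\<dots> = transpose ?M"
    by (simp add: matrix_mul_assoc[symmetric] inv(1) matrix_mul_rid)
  finally have "?M $ i $ j = transpose ?M $ i $ j"
    by (rule arg_cong)
  then show ?thesis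
    by (simp add: ginv_def transpose_def)
qed

lemma raise_lower:
  assumes "x \<in> S"
  shows "(\<Sum>m\<in>UNIV. g x $ i $ m * (\<Sum>p\<in>UNIV. ginv g x m p * v p)) = v i"
    "(\<Sum>m\<in>UNIV. ginv g x i m * (\<Sum>p\<in>UNIV. g x $ m $ p * v p)) = v i"
  using sum_delta_matrix[OF matrix_inv_works(1)[OF invertible_g[OF assms]]]
    sum_delta_matrix[OF matrix_inv_works(2)[OF invertible_g[OF assms]]]
  by (simp_all add: ginv_def)

text \<open>Cramer's rule expresses the inverse metric by determinants.\<close>

lemma smooth_ginv [smooth_intros]: "smooth_on S (\<lambda>x. ginv g x i j)"
proof (rule smooth_on_cong[OF open_S])
  let ?M = "\<lambda>x. (\<chi> a b. if b = i then axis j 1 $ a else g x $ a $ b) :: real^'n^'n"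
  have det0: "det (g x) \<noteq> 0" if "x \<in> S" for x
    using invertible_g[OF that] by (simp add: invertible_det_nz)
  show "det (?M x) * inverse (det (g x)) = ginv g x i j" if "x \<in> S" for x
  proof -
    have "g x *v (matrix_inv (g x) *v axis j 1) = axis j 1"
      using matrix_inv_works(1)[OF invertible_g[OF that]] by (simp add: matrix_vector_mul_assoc)
    from arg_cong[OF iffD1[OF cramer[OF det0[OF that]] this], of "\<lambda>v. v $ i"]
    have "(matrix_inv (g x) *v axis j 1) $ i = det (?M x) / det (g x)"
      by (simp only: vec_lambda_beta)
    moreover have "(matrix_inv (g x) *v axis j 1) $ i = ginv g x i j"
      by (simp add: matrix_vector_mult_def ginv_def axis_def)
    ultimately show ?thesis by (simp add: divide_inverse)
  qed
  have "smooth_on S (\<lambda>x. ?M x $ a $ b)" for a b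
    by (cases "b = i") (simp_all add: smooth_g smooth_on_const)
  then show "smooth_on S (\<lambda>x. det (?M x) * inverse (det (g x)))"
    by (intro smooth_on_mult smooth_on_inverse smooth_on_det open_S smooth_g det0)
qed

abbreviation \<Gamma> where "\<Gamma> \<equiv> christoffel g"

lemma smooth_christoffel [smooth_intros]: "smooth_on S (\<lambda>x. \<Gamma> x k i j)"
  unfolding christoffel_def by (intro smooth_intros open_S smooth_g)

lemma
  assumes x: "x \<in> S"
  shows christoffel_sym: "\<Gamma> x k i j = \<Gamma> x k j i"
    and metric_parallel: "pd i (\<lambda>y. g y $ j $ l) x
      = (\<Sum>m\<in>UNIV. g x $ l $ m * \<Gamma> x m i j) + (\<Sum>m\<in>UNIV. g x $ j $ m * \<Gamma> x m i l)"
proof -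
  note LC = levi_civita_iff_christoffel[where g = g, OF open_S x transpose_g invertible_g[OF x], of "\<Gamma> x"]
  show "\<Gamma> x k i j = \<Gamma> x k j i"
    using LC by blast
  have "pd i (\<lambda>y. g y $ j $ l) x - (\<Sum>m\<in>UNIV. \<Gamma> x m i j * g x $ m $ l)
      - (\<Sum>m\<in>UNIV. \<Gamma> x m i l * g x $ j $ m) = 0"
    using LC by blast
  then show "pd i (\<lambda>y. g y $ j $ l) x
      = (\<Sum>m\<in>UNIV. g x $ l $ m * \<Gamma> x m i j) + (\<Sum>m\<in>UNIV. g x $ j $ m * \<Gamma> x m i l)"
    using g_sym[OF x, of l] by (simp add: mult.commute)
qed

lemma riemann_up_christoffel:
  assumes x: "x \<in> S"
  shows "riemann_up g x i j k l = pd i (\<lambda>y. \<Gamma> y k j l) x + (\<Sum>m\<in>UNIV. \<Gamma> x k i m * \<Gamma> x m j l)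
    - pd j (\<lambda>y. \<Gamma> y k i l) x - (\<Sum>m\<in>UNIV. \<Gamma> x k j m * \<Gamma> x m i l)"
proof -
  have "(\<Sum>m\<in>UNIV. \<Gamma> x m i j * \<Gamma> x k m l) = (\<Sum>m\<in>UNIV. \<Gamma> x m j i * \<Gamma> x k m l)"
    using christoffel_sym[OF x] by metis
  then show ?thesis
    unfolding riemann_up_def Let_def nabla_mixed_def nabla_vec_def by simp
qed

lemma riemann_up_skew: "riemann_up g x j i k l = - riemann_up g x i j k l"
  by (simp add: riemann_up_def Let_def)

lemma smooth_riemann_up [smooth_intros]: "smooth_on S (\<lambda>x. riemann_up g x i j k l)"
proof (rule smooth_on_cong[OF open_S])
  show "smooth_on S (\<lambda>x. pd i (\<lambda>y. \<Gamma> y k j l) x + (\<Sum>m\<in>UNIV. \<Gamma> x k i m * \<Gamma> x m j l)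
    - pd j (\<lambda>y. \<Gamma> y k i l) x - (\<Sum>m\<in>UNIV. \<Gamma> x k j m * \<Gamma> x m i l))"
    by (intro smooth_intros open_S)
qed (simp add: riemann_up_christoffel)

lemma smooth_riemann [smooth_intros]: "smooth_on S (\<lambda>x. riemann g x i j k l)"
  unfolding riemann_def by (intro smooth_intros open_S smooth_g)

lemma smooth_schouten [smooth_intros]: "smooth_on S (\<lambda>x. schouten g x i j)"
  unfolding schouten_def schouten_J_def scalar_curv_def ricci_def divide_inverse
  by (intro smooth_intros open_S smooth_g)

lemma smooth_weyl [smooth_intros]: "smooth_on S (\<lambda>x. weyl g x i j k l)"
  unfolding weyl_def by (intro smooth_intros open_S smooth_g)

lemma smooth_weyl_dduu [smooth_intros]: "smooth_on S (\<lambda>x. weyl_dduu g x i j k l)"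
  unfolding weyl_dduu_def by (intro smooth_intros open_S smooth_g)

lemma smooth_weyl_dudd [smooth_intros]: "smooth_on S (\<lambda>x. weyl_dudd g x i j k l)"
  unfolding weyl_dudd_def by (intro smooth_intros open_S smooth_g)

text \<open>The Christoffel symbols $\Gamma_{l,ij} = g_{lm} \Gamma^m_{ij}$ of the first kind.\<close>

definition chr1 where "chr1 x l i j = (\<Sum>m\<in>UNIV. g x $ l $ m * \<Gamma> x m i j)"

lemma smooth_chr1 [smooth_intros]: "smooth_on S (\<lambda>x. chr1 x k i j)"
  unfolding chr1_def by (intro smooth_intros open_S smooth_g)

text \<open>With \<open>k\<close> lowered, the terms of $R_{ijkl}$ group so that the antisymmetry in \<open>k\<close> and \<open>l\<close>
  can be read off: $\Gamma_{k,jl} + \Gamma_{l,jk} = \partial_j g_{kl}$, and $\partial_i$ and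
  $\partial_j$ commute.\<close>

lemma riemann_chr1:
  assumes x: "x \<in> S"
  shows "riemann g x i j k l =
    pd i (\<lambda>y. chr1 y k j l) x - (\<Sum>m\<in>UNIV. chr1 x m i k * \<Gamma> x m j l)
    - (pd j (\<lambda>y. chr1 y k i l) x - (\<Sum>m\<in>UNIV. chr1 x m j k * \<Gamma> x m i l))"
proof -
  have half: "(\<Sum>m\<in>UNIV. g x $ k $ m * (pd i (\<lambda>y. \<Gamma> y m j l) x + (\<Sum>p\<in>UNIV. \<Gamma> x m i p * \<Gamma> x p j l)))
      = pd i (\<lambda>y. chr1 y k j l) x - (\<Sum>m\<in>UNIV. chr1 x m i k * \<Gamma> x m j l)" for i j
  proof -
    have "pd i (\<lambda>y. chr1 y k j l) x = (\<Sum>m\<in>UNIV. pd i (\<lambda>y. g y $ k $ m * \<Gamma> y m j l) x)"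
      unfolding chr1_def
      by (intro pd_sum diff_at x smooth_intros open_S smooth_g)
    also have "\<dots> = (\<Sum>m\<in>UNIV. (chr1 x m i k + chr1 x k i m) * \<Gamma> x m j l
        + g x $ k $ m * pd i (\<lambda>y. \<Gamma> y m j l) x)"
      using diff_at[OF smooth_g x] diff_at[OF smooth_christoffel x]
      by (simp add: pd_mult metric_parallel[OF x] chr1_def)
    finally have 1: "pd i (\<lambda>y. chr1 y k j l) x = \<dots>" .
    have "(\<Sum>m\<in>UNIV. g x $ k $ m * (\<Sum>p\<in>UNIV. \<Gamma> x m i p * \<Gamma> x p j l))
      = (\<Sum>p\<in>UNIV. \<Sum>m\<in>UNIV. g x $ k $ m * \<Gamma> x m i p * \<Gamma> x p j l)"
      unfolding sum_distrib_left by (subst sum.swap) (simp add: mult.assoc)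
    also have "\<dots> = (\<Sum>p\<in>UNIV. chr1 x k i p * \<Gamma> x p j l)"
      by (simp add: chr1_def sum_distrib_right)
    finally show ?thesis
      unfolding 1 by (simp add: distrib_left distrib_right sum.distrib)
  qed
  have "riemann g x i j k l =
      (\<Sum>m\<in>UNIV. g x $ k $ m * (pd i (\<lambda>y. \<Gamma> y m j l) x + (\<Sum>p\<in>UNIV. \<Gamma> x m i p * \<Gamma> x p j l)))
    - (\<Sum>m\<in>UNIV. g x $ k $ m * (pd j (\<lambda>y. \<Gamma> y m i l) x + (\<Sum>p\<in>UNIV. \<Gamma> x m j p * \<Gamma> x p i l)))"
    unfolding riemann_def riemann_up_christoffel[OF x]
    by (simp add: sum_subtractf[symmetric] algebra_simps)
  then show ?thesis unfolding half .
qed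

lemma riemann_skew12: "riemann g x j i k l = - riemann g x i j k l"
  unfolding riemann_def using riemann_up_skew[of x j i] by (simp add: sum_negf)

lemma riemann_skew34:
  assumes x: "x \<in> S"
  shows "riemann g x i j l k = - riemann g x i j k l"
proof -
  have dd: "pd i (\<lambda>y. chr1 y k j l) x + pd i (\<lambda>y. chr1 y l j k) x
      = pd i (pd j (\<lambda>y. g y $ k $ l)) x" for i j
  proof -
    have "pd i (\<lambda>y. chr1 y k j l + chr1 y l j k) x = pd i (pd j (\<lambda>y. g y $ k $ l)) x"
      by (rule pd_cong_open[OF open_S x]) (simp add: metric_parallel chr1_def)
    then show ?thesis
      using diff_at[OF smooth_chr1 x] by (simp add: pd_add)
  qed
  have sw: "(\<Sum>m\<in>UNIV. chr1 x m i k * \<Gamma> x m j l) = (\<Sum>m\<in>UNIV. chr1 x m j l * \<Gamma> x m i k)" for i j k l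
  proof -
    have "(\<Sum>m\<in>UNIV. chr1 x m i k * \<Gamma> x m j l)
        = (\<Sum>m\<in>UNIV. \<Sum>p\<in>UNIV. g x $ m $ p * \<Gamma> x p i k * \<Gamma> x m j l)"
      by (simp add: chr1_def sum_distrib_right)
    also have "\<dots> = (\<Sum>p\<in>UNIV. \<Sum>m\<in>UNIV. g x $ p $ m * \<Gamma> x m j l * \<Gamma> x p i k)"
      by (subst sum.swap, intro sum.cong refl) (simp add: g_sym[OF x] mult_ac)
    finally show ?thesis by (simp add: chr1_def sum_distrib_right)
  qed
  show ?thesis
    unfolding riemann_chr1[OF x]
    using dd[of i j] dd[of j i] pd_commute[OF open_S x smooth_g, of i j k l]
      sw[of i k j l] sw[of i l j k]
    by simp
qed

lemma riemann_up_riemann: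
  "x \<in> S \<Longrightarrow> riemann_up g x i j k l = (\<Sum>m\<in>UNIV. ginv g x k m * riemann g x i j m l)"
  unfolding riemann_def by (simp add: raise_lower)

text \<open>The Ricci tensor is symmetric by the first Bianchi identity, as the trace of
  $R_{ij}{}^k{}_l$ over \<open>k\<close> and \<open>l\<close> vanishes.\<close>

lemma ricci_sym:
  assumes x: "x \<in> S"
  shows "ricci g x i j = ricci g x j i"
proof -
  have pdsym: "pd a (\<lambda>y. \<Gamma> y k b c) x = pd a (\<lambda>y. \<Gamma> y k c b) x" for a b c k
    by (rule pd_cong_open[OF open_S x]) (simp add: christoffel_sym)
  have bianchi: "riemann_up g x a b k c + riemann_up g x b c k a + riemann_up g x c a k b = 0" for a b c k
    unfolding riemann_up_christoffel[OF x]
    using pdsym[of a k b c] pdsym[of b k c a] pdsym[of c k a b]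
    by (simp add: christoffel_sym[OF x, of _ b a] christoffel_sym[OF x, of _ c a]
        christoffel_sym[OF x, of _ c b])
  let ?T = "\<Sum>k\<in>UNIV. riemann_up g x i j k k"
  have "?T = (\<Sum>k\<in>UNIV. \<Sum>m\<in>UNIV. ginv g x k m * riemann g x i j m k)"
    by (simp add: riemann_up_riemann[OF x])
  also have "\<dots> = (\<Sum>m\<in>UNIV. \<Sum>k\<in>UNIV. ginv g x k m * riemann g x i j m k)"
    by (rule sum.swap)
  also have "\<dots> = (\<Sum>k\<in>UNIV. \<Sum>m\<in>UNIV. - (ginv g x k m * riemann g x i j m k))"
  proof (intro sum.cong refl)
    show "ginv g x m k * riemann g x i j k m = - (ginv g x k m * riemann g x i j m k)" for k m
      using ginv_sym[OF x, of k m] riemann_skew34[OF x, of i j k m] by simp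
  qed
  also have "\<dots> = - ?T"
    by (simp add: riemann_up_riemann[OF x] sum_negf)
  finally have T: "?T = 0" by simp
  have "0 = (\<Sum>k\<in>UNIV. riemann_up g x k i k j + riemann_up g x i j k k + riemann_up g x j k k i)"
    by (simp add: bianchi)
  also have "\<dots> = ricci g x i j + ?T - ricci g x j i"
    unfolding ricci_def using riemann_up_skew[of x _ j _ i]
    by (simp add: sum.distrib sum_negf[symmetric])
  finally show ?thesis using T by simp
qed

lemma schouten_sym: "x \<in> S \<Longrightarrow> schouten g x i j = schouten g x j i"
  unfolding schouten_def by (simp add: ricci_sym[of x i j] g_sym[of x i j])

lemma weyl_skew12: "weyl g x j i k l = - weyl g x i j k l"
  unfolding weyl_def by (simp add: riemann_skew12[of x j i])

lemma weyl_skew34: "x \<in> S \<Longrightarrow> weyl g x i j l k = - weyl g x i j k l"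
  unfolding weyl_def by (simp add: riemann_skew34[of x i j l k])

lemma weyl_dduu_skew:
  assumes x: "x \<in> S"
  shows "weyl_dduu g x j i k l = - weyl_dduu g x i j k l"
    "weyl_dduu g x i j l k = - weyl_dduu g x i j k l"
proof -
  show "weyl_dduu g x j i k l = - weyl_dduu g x i j k l"
    unfolding weyl_dduu_def weyl_skew12[of x j i] by (simp add: sum_negf)
  show "weyl_dduu g x i j l k = - weyl_dduu g x i j k l"
    unfolding weyl_dduu_def
  proof (subst sum.swap, unfold sum_negf[symmetric], intro sum.cong refl)
    show "ginv g x l b * ginv g x k a * weyl g x i j b a
        = - (ginv g x k a * ginv g x l b * weyl g x i j a b)" for a b
      using weyl_skew34[OF x, of i j a b] by simp
  qed
qed

lemma weyl_dudd_skew: "x \<in> S \<Longrightarrow> weyl_dudd g x i j l k = - weyl_dudd g x i j k l"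
  unfolding weyl_dudd_def by (simp add: sum_negf[symmetric] weyl_skew34[of x i a l k for a])

end

section \<open>Conformal change of the metric\<close>

lemma Ck_on_exp_mult:
  assumes S: "open S" and u: "smooth_on S u"
  shows "Ck_on r S (\<lambda>x. exp (c * u x))"
proof (induction r)
  case 0
  then show ?case
    using smooth_on_continuous[OF u] by (simp add: continuous_on_exp continuous_on_mult)
next
  case (Suc r)
  note du = smooth_on_differentiable[OF S _ u]
  have "Ck_on r S (pd i (\<lambda>x. exp (c * u x)))" for i
  proof (rule Ck_on_cong[OF S])
    have "Ck_on r S (pd i u)" using smooth_on_pd[OF u] by (simp add: smooth_on_def)
    then show "Ck_on r S (\<lambda>x. c * pd i u x * exp (c * u x))"
      using Suc by (intro Ck_on_mult[OF S] Ck_on_const)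
  qed (simp add: pd_exp_mult du)
  moreover have "(\<lambda>x. exp (c * u x)) differentiable_on S"
    using has_derivative_exp_mult[OF du]
    unfolding differentiable_on_eq_differentiable_at[OF S] differentiable_def by blast
  ultimately show ?case by simp
qed

lemma smooth_on_exp_mult [smooth_intros]:
  "open S \<Longrightarrow> smooth_on S u \<Longrightarrow> smooth_on S (\<lambda>x. exp (c * u x))"
  by (simp add: smooth_on_def[of S "\<lambda>x. exp (c * u x)"] Ck_on_exp_mult)

lemma invertible_scaleR:
  assumes "invertible (M :: real^'n::finite^'n)" "c \<noteq> 0"
  shows "invertible (c *\<^sub>R M)" and "matrix_inv (c *\<^sub>R M) = inverse c *\<^sub>R matrix_inv M"
proof -
  note inv = matrix_inv_works[OF assms(1)]
  have 1: "(c *\<^sub>R M) ** (inverse c *\<^sub>R matrix_inv M) = mat 1"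
    "(inverse c *\<^sub>R matrix_inv M) ** (c *\<^sub>R M) = mat 1"
    using assms(2) inv by (simp_all add: scalar_matrix_assoc[symmetric] matrix_scalar_ac)
  then show 2: "invertible (c *\<^sub>R M)"
    unfolding invertible_def by blast
  have "inverse c *\<^sub>R matrix_inv M
      = (inverse c *\<^sub>R matrix_inv M) ** ((c *\<^sub>R M) ** matrix_inv (c *\<^sub>R M))"
    by (simp only: matrix_inv_works(1)[OF 2] matrix_mul_rid)
  also have "\<dots> = matrix_inv (c *\<^sub>R M)"
    by (simp only: matrix_mul_assoc 1 matrix_mul_lid)
  finally show "matrix_inv (c *\<^sub>R M) = inverse c *\<^sub>R matrix_inv M" by simp
qed

lemma (in metric_chart) cotton_eq:
  assumes x: "x \<in> S"
  shows "cotton g x i j k =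
    pd i (\<lambda>y. schouten g y j k) x - (\<Sum>m\<in>UNIV. schouten g x j m * \<Gamma> x m i k)
    - (pd j (\<lambda>y. schouten g y i k) x - (\<Sum>m\<in>UNIV. schouten g x i m * \<Gamma> x m j k))"
  unfolding cotton_def nabla_cov2_def
  by (simp add: christoffel_sym[OF x, of _ i j] mult.commute)

text \<open>A metric together with the logarithm \<open>u\<close> of a conformal factor.\<close>

locale conformal_chart = metric_chart S g
  for S :: "(real^'n::finite) set" and g :: "real^'n \<Rightarrow> real^'n^'n" +
  fixes u :: "real^'n \<Rightarrow> real"
  assumes smooth_u: "smooth_on S u"
begin

text \<open>The rescaled metric $e^{2u} g$.\<close>

abbreviation gh :: "real^'n \<Rightarrow> real^'n^'n" where
  "gh \<equiv> \<lambda>x. exp (2 * u x) *\<^sub>R g x"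

sublocale hat: metric_chart S gh
proof
  show "open S" by (rule open_S)
  show "smooth_on S (\<lambda>x. gh x $ i $ j)" for i j
    by (simp, intro smooth_intros open_S smooth_g smooth_u)
  show "transpose (gh x) = gh x" if "x \<in> S" for x
    using transpose_g[OF that] by (simp add: transpose_scalar)
  show "invertible (gh x)" if "x \<in> S" for x
    by (rule invertible_scaleR(1)[OF invertible_g[OF that]]) simp
qed

lemma ginv_gh: "x \<in> S \<Longrightarrow> ginv gh x i j = exp (- 2 * u x) * ginv g x i j"
  unfolding ginv_def by (simp add: invertible_scaleR(2)[OF invertible_g] exp_minus)

text \<open>The gradient $\nabla^k u$, its square $|\nabla u|^2 = \nabla_m u \nabla^m u$, the Hessian
  $\nabla_i \nabla_j u$ and its mixed form $\nabla_i \nabla^k u$, and the tensor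
  $A_{ij} = - \nabla_i \nabla_j u + \nabla_i u \nabla_j u - \frac12 |\nabla u|^2 g_{ij}$ with its
  mixed form $A_i{}^k$. The Schouten tensor of the rescaled metric turns out to be $P_{ij} + A_{ij}$.\<close>

abbreviation du where "du x i \<equiv> pd i u x"

definition grad where "grad x k = (\<Sum>p\<in>UNIV. ginv g x k p * du x p)"

definition nsq where "nsq x = (\<Sum>m\<in>UNIV. du x m * grad x m)"

definition hess where "hess x i j = pd i (pd j u) x - (\<Sum>m\<in>UNIV. du x m * \<Gamma> x m i j)"

definition hess_up where
  "hess_up x i k = pd i (\<lambda>y. grad y k) x + (\<Sum>m\<in>UNIV. \<Gamma> x k i m * grad x m)"

definition A where "A x i j = - hess x i j + du x i * du x j - 1/2 * nsq x * g x $ i $ j"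

definition A_up where "A_up x i k = (\<Sum>p\<in>UNIV. ginv g x k p * A x i p)"

lemma smooth_du: "smooth_on S (\<lambda>x. du x i)"
  by (intro smooth_intros smooth_u)

lemma smooth_grad: "smooth_on S (\<lambda>x. grad x k)"
  unfolding grad_def by (intro smooth_intros open_S smooth_u)

lemma smooth_nsq: "smooth_on S nsq"
  unfolding nsq_def by (intro smooth_intros open_S smooth_u smooth_grad)

lemma smooth_hess: "smooth_on S (\<lambda>x. hess x i j)"
  unfolding hess_def by (intro smooth_intros open_S smooth_u)

lemma smooth_A: "smooth_on S (\<lambda>x. A x i j)"
  unfolding A_def by (intro smooth_intros open_S smooth_u smooth_g smooth_hess smooth_nsq)

lemma sum_g_grad: "x \<in> S \<Longrightarrow> (\<Sum>m\<in>UNIV. g x $ i $ m * grad x m) = du x i"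
  unfolding grad_def by (rule raise_lower)

lemma hess_sym: "x \<in> S \<Longrightarrow> hess x i j = hess x j i"
  unfolding hess_def
  by (simp add: pd_commute[OF open_S _ smooth_u, of x i j] christoffel_sym[of x _ i j])

lemma A_sym: "x \<in> S \<Longrightarrow> A x i j = A x j i"
  unfolding A_def by (simp add: hess_sym[of x i j] g_sym[of x i j])

lemma chr1_sym: "x \<in> S \<Longrightarrow> chr1 x k i j = chr1 x k j i"
  unfolding chr1_def by (simp add: christoffel_sym[of x _ i j])

lemma metric_parallel_chr1:
  "x \<in> S \<Longrightarrow> pd i (\<lambda>y. g y $ j $ l) x = chr1 x l i j + chr1 x j i l"
  unfolding chr1_def by (rule metric_parallel)

lemma sum_g_hess_up:
  assumes x: "x \<in> S"
  shows "(\<Sum>p\<in>UNIV. g x $ k $ p * hess_up x i p) = hess x i k"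
proof -
  have "pd i (\<lambda>y. du y k) x = pd i (\<lambda>y. \<Sum>p\<in>UNIV. g y $ k $ p * grad y p) x"
    by (rule pd_cong_open[OF open_S x]) (simp add: sum_g_grad)
  also have "\<dots> = (\<Sum>p\<in>UNIV. pd i (\<lambda>y. g y $ k $ p * grad y p) x)"
    by (intro pd_sum diff_at x smooth_intros open_S smooth_g smooth_grad)
  also have "\<dots> = (\<Sum>p\<in>UNIV. (chr1 x p i k + chr1 x k i p) * grad x p
      + g x $ k $ p * pd i (\<lambda>y. grad y p) x)"
    using diff_at[OF smooth_g x] diff_at[OF smooth_grad x]
    by (simp add: pd_mult metric_parallel_chr1[OF x])
  finally have 1: "pd i (\<lambda>y. du y k) x = \<dots>" .
  have "(\<Sum>p\<in>UNIV. chr1 x p i k * grad x p)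
      = (\<Sum>p\<in>UNIV. \<Sum>m\<in>UNIV. g x $ p $ m * \<Gamma> x m i k * grad x p)"
    by (simp add: chr1_def sum_distrib_right)
  also have "\<dots> = (\<Sum>m\<in>UNIV. (\<Sum>p\<in>UNIV. g x $ m $ p * grad x p) * \<Gamma> x m i k)"
    unfolding sum_distrib_right
    by (subst sum.swap, intro sum.cong refl) (simp add: g_sym[OF x] mult_ac)
  finally have 2: "(\<Sum>p\<in>UNIV. chr1 x p i k * grad x p) = (\<Sum>m\<in>UNIV. du x m * \<Gamma> x m i k)"
    by (simp add: sum_g_grad[OF x])
  have "(\<Sum>p\<in>UNIV. g x $ k $ p * (\<Sum>m\<in>UNIV. \<Gamma> x p i m * grad x m))
      = (\<Sum>m\<in>UNIV. \<Sum>p\<in>UNIV. g x $ k $ p * \<Gamma> x p i m * grad x m)"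
    unfolding sum_distrib_left by (subst sum.swap) (simp add: mult.assoc)
  then have 3: "(\<Sum>p\<in>UNIV. g x $ k $ p * (\<Sum>m\<in>UNIV. \<Gamma> x p i m * grad x m))
      = (\<Sum>p\<in>UNIV. chr1 x k i p * grad x p)"
    by (simp add: chr1_def sum_distrib_right)
  show ?thesis
    unfolding hess_up_def hess_def 1 using 2 3
    by (simp add: distrib_left distrib_right sum.distrib)
qed

lemma hess_up_eq: "x \<in> S \<Longrightarrow> hess_up x i k = (\<Sum>p\<in>UNIV. ginv g x k p * hess x i p)"
  using raise_lower(2)[of x k "hess_up x i"] by (simp add: sum_g_hess_up)

lemma sum_ginv_mult: "x \<in> S \<Longrightarrow> (\<Sum>p\<in>UNIV. ginv g x k p * g x $ i $ p) = (if k = i then 1 else 0)"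
  using sum_ginv_g[of x k i] by (simp add: g_sym[of x i])

lemma A_up_eq:
  assumes x: "x \<in> S"
  shows "A_up x i k = - hess_up x i k + du x i * grad x k - 1/2 * nsq x * (if k = i then 1 else 0)"
proof -
  have "A_up x i k = (\<Sum>p\<in>UNIV. - (ginv g x k p * hess x i p) + du x i * (ginv g x k p * du x p)
      - 1/2 * nsq x * (ginv g x k p * g x $ i $ p))"
    unfolding A_up_def A_def by (intro sum.cong refl) (simp add: algebra_simps)
  also have "\<dots> = - (\<Sum>p\<in>UNIV. ginv g x k p * hess x i p) + du x i * (\<Sum>p\<in>UNIV. ginv g x k p * du x p)
      - 1/2 * nsq x * (\<Sum>p\<in>UNIV. ginv g x k p * g x $ i $ p)"
    by (simp only: sum_subtractf sum.distrib sum_negf sum_distrib_left)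
  finally show ?thesis
    by (simp only: hess_up_eq[OF x] grad_def sum_ginv_mult[OF x])
qed

lemma sum_du_hess_up:
  assumes x: "x \<in> S"
  shows "(\<Sum>m\<in>UNIV. du x m * hess_up x i m) = (\<Sum>m\<in>UNIV. hess x i m * grad x m)"
proof -
  have "(\<Sum>m\<in>UNIV. du x m * hess_up x i m)
      = (\<Sum>m\<in>UNIV. \<Sum>p\<in>UNIV. du x m * (ginv g x m p * hess x i p))"
    by (simp add: hess_up_eq[OF x] sum_distrib_left)
  also have "\<dots> = (\<Sum>p\<in>UNIV. \<Sum>m\<in>UNIV. hess x i p * (ginv g x p m * du x m))"
    by (subst sum.swap, intro sum.cong refl) (simp add: ginv_sym[OF x] mult_ac)
  finally show ?thesis by (simp add: grad_def sum_distrib_left)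
qed

lemma pd_nsq:
  assumes x: "x \<in> S"
  shows "pd i nsq x = 2 * (\<Sum>m\<in>UNIV. hess x i m * grad x m)"
proof -
  have "pd i nsq x = (\<Sum>m\<in>UNIV. pd i (\<lambda>y. du y m * grad y m) x)"
    unfolding nsq_def by (intro pd_sum diff_at x smooth_intros open_S smooth_u smooth_grad)
  also have "\<dots> = (\<Sum>m\<in>UNIV. pd i (pd m u) x * grad x m + du x m * pd i (\<lambda>y. grad y m) x)"
    using diff_at[OF smooth_du x] diff_at[OF smooth_grad x] by (simp add: pd_mult)
  also have "\<dots> = (\<Sum>m\<in>UNIV. hess x i m * grad x m + du x m * hess_up x i m
      + (\<Sum>p\<in>UNIV. du x p * \<Gamma> x p i m * grad x m) - (\<Sum>p\<in>UNIV. du x m * \<Gamma> x m i p * grad x p))"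
    unfolding hess_def hess_up_def
    by (intro sum.cong refl) (simp add: algebra_simps sum_distrib_left)
  also have "\<dots> = (\<Sum>m\<in>UNIV. hess x i m * grad x m) + (\<Sum>m\<in>UNIV. du x m * hess_up x i m)
      + (\<Sum>m\<in>UNIV. \<Sum>p\<in>UNIV. du x p * \<Gamma> x p i m * grad x m)
      - (\<Sum>m\<in>UNIV. \<Sum>p\<in>UNIV. du x m * \<Gamma> x m i p * grad x p)"
    by (simp only: sum_subtractf sum.distrib)
  also have "(\<Sum>m\<in>UNIV. \<Sum>p\<in>UNIV. du x p * \<Gamma> x p i m * grad x m)
      = (\<Sum>m\<in>UNIV. \<Sum>p\<in>UNIV. du x m * \<Gamma> x m i p * grad x p)"
    by (rule sum.swap)
  finally show ?thesis by (simp add: sum_du_hess_up[OF x])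
qed

text \<open>The difference tensor $\hat\Gamma^k_{ij} - \Gamma^k_{ij}$ of the two connections.\<close>

definition D where
  "D x k i j = (if k = i then 1 else 0) * du x j + (if k = j then 1 else 0) * du x i
    - g x $ i $ j * grad x k"

lemma christoffel_gh:
  assumes x: "x \<in> S"
  shows "christoffel gh x k i j = \<Gamma> x k i j + D x k i j"
proof -
  have dg: "pd i (\<lambda>y. gh y $ j $ l) x
      = exp (2 * u x) * (2 * du x i * g x $ j $ l + pd i (\<lambda>y. g y $ j $ l) x)" for i j l
  proof -
    have "(\<lambda>y. exp (2 * u y)) differentiable (at x)"
      by (intro diff_at smooth_intros open_S smooth_u x)
    then show ?thesis
      unfolding vector_scaleR_component real_scaleR_def
      using diff_at[OF smooth_g x] diff_at[OF smooth_u x]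
      by (simp add: pd_mult pd_exp_mult distrib_left)
  qed
  have "christoffel gh x k i j = (\<Sum>l\<in>UNIV. 1/2 * (ginv g x k l * (pd i (\<lambda>y. g y $ j $ l) x
        + pd j (\<lambda>y. g y $ i $ l) x - pd l (\<lambda>y. g y $ i $ j) x))
      + du x i * (ginv g x k l * g x $ j $ l) + du x j * (ginv g x k l * g x $ i $ l)
      - g x $ i $ j * (ginv g x k l * du x l))"
    unfolding christoffel_def dg ginv_gh[OF x] sum_distrib_left
    by (intro sum.cong refl) (simp add: exp_minus field_simps)
  also have "\<dots> = \<Gamma> x k i j + D x k i j"
    unfolding christoffel_def D_def sum_subtractf sum.distrib sum_distrib_left[symmetric]
      sum_ginv_mult[OF x] grad_def by simp
  finally show ?thesis .
qed

lemma sum_mult_D: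
  "(\<Sum>m\<in>UNIV. f m * D x m j l) = f j * du x l + f l * du x j - g x $ j $ l * (\<Sum>m\<in>UNIV. f m * grad x m)"
proof -
  have "(\<Sum>m\<in>UNIV. f m * D x m j l) = (\<Sum>m\<in>UNIV. (f m * (if m = j then 1 else 0)) * du x l
      + (f m * (if m = l then 1 else 0)) * du x j - g x $ j $ l * (f m * grad x m))"
    unfolding D_def by (intro sum.cong refl) (simp add: algebra_simps)
  then show ?thesis
    by (simp only: sum_subtractf sum.distrib sum_distrib_left[symmetric]
        sum_distrib_right[symmetric] sum_delta_mult)
qed

lemma sum_D_mult:
  "(\<Sum>m\<in>UNIV. D x k i m * t m) = (if k = i then 1 else 0) * (\<Sum>m\<in>UNIV. du x m * t m)
    + du x i * t k - grad x k * (\<Sum>m\<in>UNIV. g x $ i $ m * t m)"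
proof -
  have "(\<Sum>m\<in>UNIV. D x k i m * t m) = (\<Sum>m\<in>UNIV. (if k = i then 1 else 0) * (du x m * t m)
      + du x i * ((if k = m then 1 else 0) * t m) - grad x k * (g x $ i $ m * t m))"
    unfolding D_def by (intro sum.cong refl) (simp add: algebra_simps)
  then show ?thesis
    by (simp only: sum_subtractf sum.distrib sum_distrib_left[symmetric]
        sum_distrib_right[symmetric] sum_delta_mult)
qed

lemma pd_D:
  assumes x: "x \<in> S"
  shows "pd i (\<lambda>y. D y k j l) x = (if k = j then 1 else 0) * pd i (pd l u) x
    + (if k = l then 1 else 0) * pd i (pd j u) x
    - (pd i (\<lambda>y. g y $ j $ l) x * grad x k + g x $ j $ l * pd i (\<lambda>y. grad y k) x)"
proof -
  have dif: "(\<lambda>y. c * du y a) differentiable (at x)" "(\<lambda>y. g y $ j $ l * grad y k) differentiable (at x)"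
    "(\<lambda>y. c * du y a + d * du y b) differentiable (at x)" for c d a b
    by (intro diff_at smooth_intros open_S smooth_u x smooth_g smooth_grad)+
  have cm: "pd i (\<lambda>y. c * du y a) x = c * pd i (pd a u) x" for c a
    using diff_at[OF smooth_du x] diff_at[OF smooth_on_const x] by (subst pd_mult) auto
  show ?thesis
    unfolding D_def
    using diff_at[OF smooth_g x] diff_at[OF smooth_grad x]
    by (simp only: pd_add pd_diff dif cm pd_mult)
qed

text \<open>The change of the curvature: the covariant derivatives of \<open>D\<close> and the terms quadratic in \<open>D\<close>
  combine into the Kulkarni--Nomizu product of \<open>A\<close> and \<open>g\<close>, here with \<open>k\<close> raised.\<close>

lemma riemann_up_gh:
  assumes x: "x \<in> S"
  shows "riemann_up gh x i j k l = riemann_up g x i j k l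
    + A_up x i k * g x $ j $ l - A x i l * (if k = j then 1 else 0)
    + A x j l * (if k = i then 1 else 0) - A_up x j k * g x $ i $ l"
proof -
  let ?\<delta> = "\<lambda>a b :: 'n. if a = b then 1 else (0::real)"
  have pdG: "pd i (\<lambda>y. christoffel gh y k j l) x = pd i (\<lambda>y. \<Gamma> y k j l) x + pd i (\<lambda>y. D y k j l) x" for i j
  proof -
    have "pd i (\<lambda>y. christoffel gh y k j l) x = pd i (\<lambda>y. \<Gamma> y k j l + D y k j l) x"
      by (rule pd_cong_open[OF open_S x]) (simp add: christoffel_gh)
    moreover have "(\<lambda>y. D y k j l) differentiable (at x)"
      unfolding D_def by (intro diff_at smooth_intros open_S smooth_u x smooth_g smooth_grad)
    ultimately show ?thesis
      using diff_at[OF smooth_christoffel x] by (simp add: pd_add)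
  qed
  have Dgrad: "(\<Sum>m\<in>UNIV. D x k i m * grad x m) = ?\<delta> k i * nsq x" for i
    unfolding sum_D_mult sum_g_grad[OF x] nsq_def by simp
  have quad: "(\<Sum>m\<in>UNIV. christoffel gh x k i m * christoffel gh x m j l)
      = (\<Sum>m\<in>UNIV. \<Gamma> x k i m * \<Gamma> x m j l)
      + (\<Gamma> x k i j * du x l + \<Gamma> x k i l * du x j - g x $ j $ l * (\<Sum>m\<in>UNIV. \<Gamma> x k i m * grad x m))
      + (?\<delta> k i * (\<Sum>m\<in>UNIV. du x m * \<Gamma> x m j l) + du x i * \<Gamma> x k j l - grad x k * chr1 x i j l)
      + (D x k i j * du x l + D x k i l * du x j - g x $ j $ l * (?\<delta> k i * nsq x))" for i j
  proof -
    have "(\<Sum>m\<in>UNIV. christoffel gh x k i m * christoffel gh x m j l)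
      = (\<Sum>m\<in>UNIV. \<Gamma> x k i m * \<Gamma> x m j l) + (\<Sum>m\<in>UNIV. \<Gamma> x k i m * D x m j l)
        + (\<Sum>m\<in>UNIV. D x k i m * \<Gamma> x m j l) + (\<Sum>m\<in>UNIV. D x k i m * D x m j l)"
      unfolding christoffel_gh[OF x] by (simp add: distrib_left distrib_right sum.distrib)
    then show ?thesis
      unfolding sum_mult_D sum_D_mult[of x k i "\<lambda>m. \<Gamma> x m j l"] Dgrad chr1_def[symmetric] .
  qed
  have \<Gamma>s: "\<Gamma> x k j i = \<Gamma> x k i j"
    and gs: "g x $ j $ i = g x $ i $ j"
    and cs: "chr1 x l j i = chr1 x l i j"
    and us: "pd j (pd i u) x = pd i (pd j u) x"
    using christoffel_sym[OF x] g_sym[OF x] chr1_sym[OF x] pd_commute[OF open_S x smooth_u] by auto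
  show ?thesis
    unfolding hat.riemann_up_christoffel[OF x] riemann_up_christoffel[OF x] pdG quad pd_D[OF x]
      A_up_eq[OF x] A_def hess_def hess_up_def metric_parallel_chr1[OF x]
    unfolding D_def
    by (simp add: \<Gamma>s gs cs us algebra_simps)
qed

lemma riemann_gh:
  assumes x: "x \<in> S"
  shows "riemann gh x i j k l = exp (2 * u x) * (riemann g x i j k l
    + A x i k * g x $ j $ l - A x i l * g x $ j $ k + A x j l * g x $ i $ k - A x j k * g x $ i $ l)"
proof -
  have lower: "(\<Sum>m\<in>UNIV. g x $ k $ m * A_up x i m) = A x i k" for i
    unfolding A_up_def by (rule raise_lower[OF x])
  have "riemann gh x i j k l = exp (2 * u x) * (\<Sum>m\<in>UNIV. g x $ k $ m * riemann_up g x i j m l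
      + (g x $ k $ m * A_up x i m) * g x $ j $ l - A x i l * (g x $ k $ m * (if m = j then 1 else 0))
      + A x j l * (g x $ k $ m * (if m = i then 1 else 0)) - (g x $ k $ m * A_up x j m) * g x $ i $ l)"
    unfolding riemann_def riemann_up_gh[OF x] sum_distrib_left
    by (intro sum.cong refl) (simp add: algebra_simps)
  also have "\<dots> = exp (2 * u x) * (riemann g x i j k l
      + A x i k * g x $ j $ l - A x i l * g x $ k $ j + A x j l * g x $ k $ i - A x j k * g x $ i $ l)"
    unfolding sum_subtractf sum.distrib sum_distrib_left[symmetric] sum_distrib_right[symmetric]
      sum_delta_mult lower riemann_def ..
  finally show ?thesis by (simp only: g_sym[OF x, of k])
qed

text \<open>The trace $A_k{}^k$.\<close>

definition trA where "trA x = (\<Sum>k\<in>UNIV. A_up x k k)"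

lemma ricci_gh:
  assumes x: "x \<in> S"
  shows "ricci gh x i j = ricci g x i j + (real CARD('n) - 2) * A x i j + trA x * g x $ i $ j"
proof -
  have lower: "(\<Sum>k\<in>UNIV. g x $ k $ j * A_up x i k) = A x i j"
    using raise_lower(1)[OF x, of j "A x i"] g_sym[OF x, of j] by (simp add: A_up_def)
  have "ricci gh x i j = (\<Sum>k\<in>UNIV. riemann_up g x k i k j + A_up x k k * g x $ i $ j
      - A x k j * (if k = i then 1 else 0) + A x i j - g x $ k $ j * A_up x i k)"
    unfolding ricci_def riemann_up_gh[OF x]
    by (intro sum.cong refl) simp
  also have "\<dots> = ricci g x i j + trA x * g x $ i $ j - A x i j + real CARD('n) * A x i j - A x i j"
    unfolding sum_subtractf sum.distrib sum_distrib_right[symmetric] sum_delta_mult lower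
    by (simp add: ricci_def trA_def)
  finally show ?thesis by (simp add: algebra_simps)
qed

lemma scalar_curv_gh:
  assumes x: "x \<in> S"
  shows "scalar_curv gh x = exp (- 2 * u x) * (scalar_curv g x + 2 * (real CARD('n) - 1) * trA x)"
proof -
  have tr1: "(\<Sum>i\<in>UNIV. \<Sum>j\<in>UNIV. ginv g x i j * A x i j) = trA x"
    by (simp add: trA_def A_up_def)
  have tr2: "(\<Sum>i\<in>UNIV. \<Sum>j\<in>UNIV. ginv g x i j * g x $ i $ j) = real CARD('n)"
    by (simp add: sum_ginv_mult[OF x])
  have "scalar_curv gh x = exp (- 2 * u x) * (\<Sum>i\<in>UNIV. \<Sum>j\<in>UNIV. ginv g x i j * ricci g x i j
      + (real CARD('n) - 2) * (ginv g x i j * A x i j) + trA x * (ginv g x i j * g x $ i $ j))"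
    unfolding scalar_curv_def ginv_gh[OF x] ricci_gh[OF x] sum_distrib_left
    by (intro sum.cong refl) (simp add: algebra_simps)
  also have "\<dots> = exp (- 2 * u x) * (scalar_curv g x + (real CARD('n) - 2) * trA x + trA x * real CARD('n))"
    unfolding sum.distrib sum_distrib_left[symmetric] tr1 tr2 scalar_curv_def ..
  finally show ?thesis by (simp add: algebra_simps)
qed

lemma schouten_gh:
  assumes x: "x \<in> S" and n: "CARD('n) > 2"
  shows "schouten gh x i j = schouten g x i j + A x i j"
proof -
  have n': "real CARD('n) > 2" using n by simp
  have J: "schouten_J gh x = exp (- 2 * u x) * (schouten_J g x + trA x)"
    unfolding schouten_J_def scalar_curv_gh[OF x] using n' by (simp add: field_simps)
  have "schouten gh x i j = 1 / (real CARD('n) - 2) *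
      (ricci g x i j - schouten_J g x * g x $ i $ j + (real CARD('n) - 2) * A x i j)"
  proof -
    have "schouten_J gh x * gh x $ i $ j = (schouten_J g x + trA x) * g x $ i $ j"
      unfolding J by (simp add: exp_minus)
    then show ?thesis
      unfolding schouten_def ricci_gh[OF x] by (simp add: algebra_simps)
  qed
  then show ?thesis
    unfolding schouten_def using n' by (simp add: distrib_left)
qed

lemma weyl_gh:
  assumes x: "x \<in> S" and n: "CARD('n) > 2"
  shows "weyl gh x i j k l = exp (2 * u x) * weyl g x i j k l"
  unfolding weyl_def riemann_gh[OF x] schouten_gh[OF x n] by (simp add: algebra_simps)

lemma weyl_dduu_gh:
  assumes x: "x \<in> S" and n: "CARD('n) > 2"
  shows "weyl_dduu gh x i j k l = exp (- 2 * u x) * weyl_dduu g x i j k l"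
  unfolding weyl_dduu_def weyl_gh[OF x n] ginv_gh[OF x] sum_distrib_left
  by (intro sum.cong refl) (simp add: exp_minus field_simps)

lemma weyl_dudd_gh:
  assumes x: "x \<in> S" and n: "CARD('n) > 2"
  shows "weyl_dudd gh x i j k l = weyl_dudd g x i j k l"
  unfolding weyl_dudd_def weyl_gh[OF x n] ginv_gh[OF x]
  by (intro sum.cong refl) (simp add: exp_minus field_simps)

text \<open>The Ricci identity
  $\nabla_i \nabla_j \nabla_k u - \nabla_j \nabla_i \nabla_k u = - R_{ij}{}^l{}_k \nabla_l u$.\<close>

lemma ricci_identity_du:
  assumes x: "x \<in> S"
  shows "pd i (\<lambda>y. hess y j k) x - (\<Sum>m\<in>UNIV. hess x j m * \<Gamma> x m i k)
    - (pd j (\<lambda>y. hess y i k) x - (\<Sum>m\<in>UNIV. hess x i m * \<Gamma> x m j k))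
    = - (\<Sum>l\<in>UNIV. riemann_up g x i j l k * du x l)"
proof -
  let ?q = "\<lambda>i j. \<Sum>l\<in>UNIV. du x l * (\<Sum>m\<in>UNIV. \<Gamma> x l i m * \<Gamma> x m j k)"
  have nh: "pd i (\<lambda>y. hess y j k) x - (\<Sum>m\<in>UNIV. hess x j m * \<Gamma> x m i k)
      = pd i (pd j (pd k u)) x - (\<Sum>m\<in>UNIV. du x m * pd i (\<lambda>y. \<Gamma> y m j k) x)
      - (\<Sum>m\<in>UNIV. pd i (pd m u) x * \<Gamma> x m j k) - (\<Sum>m\<in>UNIV. pd j (pd m u) x * \<Gamma> x m i k) + ?q j i" for i j
  proof -
    have "pd i (\<lambda>y. hess y j k) x
        = pd i (pd j (pd k u)) x - pd i (\<lambda>y. \<Sum>m\<in>UNIV. du y m * \<Gamma> y m j k) x"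
      unfolding hess_def
      by (intro pd_diff diff_at x smooth_intros open_S smooth_u)
    also have "pd i (\<lambda>y. \<Sum>m\<in>UNIV. du y m * \<Gamma> y m j k) x
        = (\<Sum>m\<in>UNIV. pd i (\<lambda>y. du y m * \<Gamma> y m j k) x)"
      by (intro pd_sum diff_at x smooth_intros open_S smooth_u)
    also have "\<dots> = (\<Sum>m\<in>UNIV. pd i (pd m u) x * \<Gamma> x m j k) + (\<Sum>m\<in>UNIV. du x m * pd i (\<lambda>y. \<Gamma> y m j k) x)"
      using diff_at[OF smooth_du x] diff_at[OF smooth_christoffel x]
      by (simp add: pd_mult sum.distrib)
    finally have 1: "pd i (\<lambda>y. hess y j k) x = pd i (pd j (pd k u)) x -
      ((\<Sum>m\<in>UNIV. pd i (pd m u) x * \<Gamma> x m j k) + (\<Sum>m\<in>UNIV. du x m * pd i (\<lambda>y. \<Gamma> y m j k) x))" .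
    have "(\<Sum>m\<in>UNIV. (\<Sum>l\<in>UNIV. du x l * \<Gamma> x l j m) * \<Gamma> x m i k)
        = (\<Sum>l\<in>UNIV. \<Sum>m\<in>UNIV. du x l * \<Gamma> x l j m * \<Gamma> x m i k)"
      unfolding sum_distrib_right by (rule sum.swap)
    also have "\<dots> = ?q j i" by (simp add: sum_distrib_left mult.assoc)
    finally show ?thesis
      unfolding 1 by (simp add: hess_def left_diff_distrib sum_subtractf)
  qed
  have "(\<Sum>l\<in>UNIV. riemann_up g x i j l k * du x l)
      = (\<Sum>m\<in>UNIV. du x m * pd i (\<lambda>y. \<Gamma> y m j k) x) + ?q i j
      - (\<Sum>m\<in>UNIV. du x m * pd j (\<lambda>y. \<Gamma> y m i k) x) - ?q j i"
    unfolding riemann_up_christoffel[OF x] sum.distrib[symmetric] sum_subtractf[symmetric]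
    by (intro sum.cong refl) (simp add: algebra_simps)
  then show ?thesis
    unfolding nh using pd_commute[OF open_S x smooth_on_pd[OF smooth_u], of i j k] by simp
qed

text \<open>The skew part $\nabla_i A_{jk} - \nabla_j A_{ik}$.\<close>

lemma nabla_A_skew:
  assumes x: "x \<in> S"
  shows "pd i (\<lambda>y. A y j k) x - (\<Sum>m\<in>UNIV. A x j m * \<Gamma> x m i k)
    - (pd j (\<lambda>y. A y i k) x - (\<Sum>m\<in>UNIV. A x i m * \<Gamma> x m j k))
    = (\<Sum>l\<in>UNIV. riemann_up g x i j l k * du x l)
      + du x j * hess x i k - du x i * hess x j k
      - (\<Sum>m\<in>UNIV. hess x i m * grad x m) * g x $ j $ k + (\<Sum>m\<in>UNIV. hess x j m * grad x m) * g x $ i $ k"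
proof -
  have nA: "pd i (\<lambda>y. A y j k) x - (\<Sum>m\<in>UNIV. A x j m * \<Gamma> x m i k)
      = - (pd i (\<lambda>y. hess y j k) x - (\<Sum>m\<in>UNIV. hess x j m * \<Gamma> x m i k))
        + pd i (pd j u) x * du x k + du x j * hess x i k
        - (\<Sum>m\<in>UNIV. hess x i m * grad x m) * g x $ j $ k - 1/2 * nsq x * chr1 x k i j" for i j
  proof -
    have d: "(\<lambda>y. hess y j k) differentiable (at x)" "(\<lambda>y. - hess y j k) differentiable (at x)"
        "(\<lambda>y. du y j * du y k) differentiable (at x)"
        "(\<lambda>y. - hess y j k + du y j * du y k) differentiable (at x)"
        "(\<lambda>y. 1/2 * nsq y) differentiable (at x)" "nsq differentiable (at x)"
        "(\<lambda>y. g y $ j $ k) differentiable (at x)" "pd a u differentiable (at x)"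
        "(\<lambda>y. 1/2 * nsq y * g y $ j $ k) differentiable (at x)" for a
      by (intro diff_at x smooth_intros open_S smooth_u smooth_g smooth_hess smooth_nsq)+
    have "pd i (\<lambda>y. 1/2 * nsq y) x = 1/2 * pd i nsq x"
      using d(6) diff_at[OF smooth_on_const x] by (subst pd_mult) auto
    then have "pd i (\<lambda>y. A y j k) x = - pd i (\<lambda>y. hess y j k) x
        + (pd i (pd j u) x * du x k + du x j * pd i (pd k u) x)
        - ((\<Sum>m\<in>UNIV. hess x i m * grad x m) * g x $ j $ k + 1/2 * nsq x * (chr1 x k i j + chr1 x j i k))"
      unfolding A_def using d
      by (simp only: pd_diff pd_add pd_minus pd_mult pd_nsq[OF x] metric_parallel_chr1[OF x])
    moreover have "(\<Sum>m\<in>UNIV. A x j m * \<Gamma> x m i k)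
        = - (\<Sum>m\<in>UNIV. hess x j m * \<Gamma> x m i k) + du x j * (\<Sum>m\<in>UNIV. du x m * \<Gamma> x m i k)
          - 1/2 * nsq x * chr1 x j i k"
      unfolding A_def chr1_def sum_distrib_left sum_negf[symmetric] sum.distrib[symmetric]
        sum_subtractf[symmetric]
      by (intro sum.cong refl) (simp add: algebra_simps)
    ultimately show ?thesis
      unfolding hess_def[of x i k] by (simp add: algebra_simps)
  qed
  have us: "pd j (pd i u) x = pd i (pd j u) x"
    by (rule pd_commute[OF open_S x smooth_u])
  show ?thesis
    unfolding nA using ricci_identity_du[OF x, of i j k] chr1_sym[OF x, of k i j] us
    by (simp add: algebra_simps)
qed

text \<open>The Schouten part of the curvature term in \<open>nabla_A_skew\<close> and the Hessian terms there cancel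
  against the contribution of the difference tensor \<open>D\<close>. The Weyl part remains.\<close>

lemma cotton_gh:
  assumes x: "x \<in> S" and n: "CARD('n) > 2"
  shows "cotton gh x i j k = cotton g x i j k + (\<Sum>l\<in>UNIV. grad x l * weyl g x i j l k)"
proof -
  let ?P = "schouten g x"
  have pdP: "pd i (\<lambda>y. schouten gh y j k) x = pd i (\<lambda>y. schouten g y j k) x + pd i (\<lambda>y. A y j k) x" for i j
  proof -
    have "pd i (\<lambda>y. schouten gh y j k) x = pd i (\<lambda>y. schouten g y j k + A y j k) x"
      by (rule pd_cong_open[OF open_S x]) (simp add: schouten_gh n)
    then show ?thesis
      using diff_at[OF smooth_schouten x] diff_at[OF smooth_A x] by (simp add: pd_add)
  qed
  have sumA: "(\<Sum>m\<in>UNIV. A x j m * grad x m) = - (\<Sum>m\<in>UNIV. hess x j m * grad x m) + 1/2 * nsq x * du x j" for j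
  proof -
    have "(\<Sum>m\<in>UNIV. A x j m * grad x m) = - (\<Sum>m\<in>UNIV. hess x j m * grad x m)
        + du x j * (\<Sum>m\<in>UNIV. du x m * grad x m) - 1/2 * nsq x * (\<Sum>m\<in>UNIV. g x $ j $ m * grad x m)"
      unfolding A_def sum_distrib_left sum_negf[symmetric] sum.distrib[symmetric]
        sum_subtractf[symmetric]
      by (intro sum.cong refl) (simp add: algebra_simps)
    then show ?thesis
      by (simp add: nsq_def[symmetric] sum_g_grad[OF x])
  qed
  have conn: "(\<Sum>m\<in>UNIV. schouten gh x j m * christoffel gh x m i k)
      = (\<Sum>m\<in>UNIV. ?P j m * \<Gamma> x m i k) + (\<Sum>m\<in>UNIV. A x j m * \<Gamma> x m i k)
        + ((?P j i + A x j i) * du x k + (?P j k + A x j k) * du x i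
           - g x $ i $ k * ((\<Sum>m\<in>UNIV. ?P j m * grad x m) + (\<Sum>m\<in>UNIV. A x j m * grad x m)))" for i j
  proof -
    have "(\<Sum>m\<in>UNIV. schouten gh x j m * christoffel gh x m i k)
      = (\<Sum>m\<in>UNIV. ?P j m * \<Gamma> x m i k) + (\<Sum>m\<in>UNIV. A x j m * \<Gamma> x m i k)
        + (\<Sum>m\<in>UNIV. (?P j m + A x j m) * D x m i k)"
      unfolding christoffel_gh[OF x] schouten_gh[OF x n]
      by (simp add: distrib_left distrib_right sum.distrib)
    then show ?thesis
      unfolding sum_mult_D by (simp add: distrib_right sum.distrib)
  qed
  have R: "(\<Sum>l\<in>UNIV. riemann_up g x i j l k * du x l) = (\<Sum>l\<in>UNIV. grad x l * weyl g x i j l k)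
      + (\<Sum>m\<in>UNIV. ?P i m * grad x m) * g x $ j $ k - ?P i k * du x j
      + ?P j k * du x i - (\<Sum>m\<in>UNIV. ?P j m * grad x m) * g x $ i $ k"
  proof -
    have "(\<Sum>l\<in>UNIV. riemann_up g x i j l k * du x l)
        = (\<Sum>l\<in>UNIV. \<Sum>m\<in>UNIV. ginv g x l m * riemann g x i j m k * du x l)"
      by (simp add: riemann_up_riemann[OF x] sum_distrib_right)
    also have "\<dots> = (\<Sum>m\<in>UNIV. \<Sum>l\<in>UNIV. riemann g x i j m k * (ginv g x m l * du x l))"
      by (subst sum.swap, intro sum.cong refl) (simp add: ginv_sym[OF x] mult_ac)
    also have "\<dots> = (\<Sum>m\<in>UNIV. riemann g x i j m k * grad x m)"
      by (simp add: grad_def sum_distrib_left)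
    also have "\<dots> = (\<Sum>m\<in>UNIV. grad x m * weyl g x i j m k + (?P i m * grad x m) * g x $ j $ k
        - ?P i k * (g x $ j $ m * grad x m) + ?P j k * (g x $ i $ m * grad x m)
        - (?P j m * grad x m) * g x $ i $ k)"
      unfolding weyl_def by (intro sum.cong refl) (simp add: algebra_simps)
    also have "\<dots> = (\<Sum>l\<in>UNIV. grad x l * weyl g x i j l k)
      + (\<Sum>m\<in>UNIV. ?P i m * grad x m) * g x $ j $ k - ?P i k * du x j
      + ?P j k * du x i - (\<Sum>m\<in>UNIV. ?P j m * grad x m) * g x $ i $ k"
      unfolding sum_subtractf sum.distrib sum_distrib_left[symmetric] sum_distrib_right[symmetric]
        sum_g_grad[OF x] ..
    finally show ?thesis .
  qed
  have Ps: "?P j i = ?P i j" "A x j i = A x i j"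
    using schouten_sym[OF x] A_sym[OF x] by auto
  have exp: "A x i k = - hess x i k + du x i * du x k - 1/2 * nsq x * g x $ i $ k" for i
    by (rule A_def)
  show ?thesis
    unfolding hat.cotton_eq[OF x] cotton_eq[OF x] pdP conn sumA Ps exp
    using nabla_A_skew[OF x, of i j k] R
    by (simp add: algebra_simps)
qed

end

section \<open>Alternating functions of multi-indices\<close>

lemma finite_multi [simp]: "finite (multi n :: (nat \<Rightarrow> 'n::finite) set)"
  unfolding multi_def by (intro finite_PiE) auto

lemma multi_comp: "\<tau> permutes {1..n} \<Longrightarrow> I \<in> multi n \<Longrightarrow> I \<circ> \<tau> \<in> multi n"
  unfolding multi_def by (auto simp: PiE_iff extensional_def permutes_not_in)

lemma multi_upd: "a \<in> {1..n} \<Longrightarrow> I \<in> multi n \<Longrightarrow> I(a := m) \<in> multi n"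
  unfolding multi_def by (auto simp: PiE_iff extensional_def)

lemma multi1_iff: "I \<in> multi1 n i \<longleftrightarrow> I \<in> multi n \<and> I 1 = i"
  by (auto simp: multi1_def)

lemma sum_multi_permute:
  fixes f :: "(nat \<Rightarrow> 'n::finite) \<Rightarrow> real"
  assumes \<tau>: "\<tau> permutes {1..n}"
  shows "(\<Sum>I\<in>multi n. f I) = (\<Sum>I\<in>multi n. f (I \<circ> \<tau>))"
  by (rule sum.reindex_bij_witness[of _ "\<lambda>I. I \<circ> \<tau>" "\<lambda>I. I \<circ> inv \<tau>"])
    (use \<tau> in \<open>auto simp: comp_assoc permutes_inv_o multi_comp permutes_inv\<close>)

text \<open>An alternating function of \<open>n\<close> indices changes its sign when two indices are exchanged. Only its
  values on \<open>multi n\<close> matter.\<close>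

definition alternating :: "nat \<Rightarrow> ((nat \<Rightarrow> 'n) \<Rightarrow> real) \<Rightarrow> bool" where
  "alternating n e \<longleftrightarrow> (\<forall>I\<in>multi n. \<forall>a\<in>{1..n}. \<forall>b\<in>{1..n}. a \<noteq> b \<longrightarrow>
     e (I \<circ> Transposition.transpose a b) = - e I)"

lemma alternatingD:
  "alternating n e \<Longrightarrow> I \<in> multi n \<Longrightarrow> a \<in> {1..n} \<Longrightarrow> b \<in> {1..n} \<Longrightarrow> a \<noteq> b \<Longrightarrow>
    e (I \<circ> Transposition.transpose a b) = - e I"
  by (simp add: alternating_def)

lemma alternating_repeated:
  assumes "alternating n e" "I \<in> multi n" "a \<in> {1..n}" "b \<in> {1..n}" "a \<noteq> b" "I a = I b"
  shows "e I = 0"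
proof -
  have "I \<circ> Transposition.transpose a b = I"
    using assms(6) by (auto simp: fun_eq_iff Transposition.transpose_def)
  then show ?thesis
    using alternatingD[OF assms(1-5)] by simp
qed

text \<open>In dimension \<open>n\<close> an alternating function of \<open>n + 1\<close> indices vanishes. Written out for the
  alternation over $i_1, \ldots, i_n, m$ of $e_{i_1\cdots i_n} \delta_m^l$, this says
  $\delta_m^l e_{i_1 \cdots i_n} = \sum_a \delta_{i_a}^l e_{i_1 \cdots m \cdots i_n}$ with \<open>m\<close> in
  position \<open>a\<close>.\<close>

lemma alternating_exchange:
  fixes e :: "(nat \<Rightarrow> 'n::finite) \<Rightarrow> real"
  assumes e: "alternating n e" and n: "CARD('n) = n" and I: "I \<in> multi n"
  shows "(\<Sum>a\<in>{1..n}. if I a = l then e (I(a := m)) else 0) = (if l = m then e I else 0)"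
proof (cases "inj_on I {1..n}")
  case True
  have surj: "I ` {1..n} = UNIV"
    using card_image[OF True] n by (intro card_subset_eq) auto
  obtain a where a: "a \<in> {1..n}" "I a = l"
    using surj by (metis UNIV_I imageE)
  have "(\<Sum>c\<in>{1..n}. if I c = l then e (I(c := m)) else 0)
      = (\<Sum>c\<in>{1..n}. if c = a then e (I(a := m)) else 0)"
    using True a by (intro sum.cong refl) (auto dest: inj_onD)
  also have "\<dots> = e (I(a := m))"
    using a by simp
  also have "\<dots> = (if l = m then e I else 0)"
  proof (cases "l = m")
    case True
    then show ?thesis using a(2) by auto
  next
    case False
    obtain b where b: "b \<in> {1..n}" "I b = m"
      using surj by (metis UNIV_I imageE)
    then have "e (I(a := m)) = 0"
      using a b False multi_upd[OF a(1) I]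
      by (intro alternating_repeated[OF e _ a(1) b(1)]) auto
    then show ?thesis using False by simp
  qed
  finally show ?thesis .
next
  case False
  then obtain a b where ab: "a \<in> {1..n}" "b \<in> {1..n}" "a \<noteq> b" "I a = I b"
    by (auto simp: inj_on_def)
  have "e (I(c := m)) = 0" if "c \<in> {1..n}" "c \<noteq> a" "c \<noteq> b" for c
    by (rule alternating_repeated[OF e multi_upd[OF that(1) I] ab(1-3)]) (use ab that in auto)
  then have "(\<Sum>c\<in>{1..n}. if I c = l then e (I(c := m)) else 0)
      = (\<Sum>c\<in>{a, b}. if I c = l then e (I(c := m)) else 0)"
    using ab by (intro sum.mono_neutral_right) auto
  also have "\<dots> = 0"
  proof -
    have "I(b := m) = I(a := m) \<circ> Transposition.transpose a b"
      using ab by (auto simp: fun_eq_iff Transposition.transpose_def)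
    then have "e (I(b := m)) = - e (I(a := m))"
      using alternatingD[OF e multi_upd[OF ab(1) I] ab(1-3)] by simp
    then show ?thesis using ab by simp
  qed
  also have "0 = (if l = m then e I else 0)"
    using alternating_repeated[OF e I ab] by simp
  finally show ?thesis .
qed

text \<open>The exchange of the pair of positions $(1, 2)$ with the pair $(2b - 1, 2b)$; the identity if
  $b = 1$.\<close>

definition pair_exchange :: "nat \<Rightarrow> nat \<Rightarrow> nat" where
  "pair_exchange b = Transposition.transpose 1 (2 * b - 1) \<circ> Transposition.transpose 2 (2 * b)"

lemma pair_exchange_permutes:
  assumes "b \<in> {1..k}"
  shows "pair_exchange b permutes {1..2 * k}"
  unfolding pair_exchange_def using assms
  by (intro permutes_compose permutes_swap_id) auto

lemma pair_exchange_apply: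
  assumes "b \<ge> 1" "a \<ge> 1"
  shows "pair_exchange b (2 * a - 1) = 2 * Transposition.transpose 1 b a - 1"
    "pair_exchange b (2 * a) = 2 * Transposition.transpose 1 b a"
proof -
  have "2 * a - 1 \<noteq> 2 * b" "2 * a - 1 \<noteq> 2" "2 * a \<noteq> 2 * b - 1" "2 * a \<noteq> 1" "2 * b \<noteq> 1"
    "2 * b \<noteq> 2 * b - 1" "2 \<noteq> 2 * b - 1" "2 * a - 1 = 2 * b - 1 \<longleftrightarrow> a = b" "2 * a - 1 = 1 \<longleftrightarrow> a = 1"
    using assms by presburger+
  then show "pair_exchange b (2 * a - 1) = 2 * Transposition.transpose 1 b a - 1"
    "pair_exchange b (2 * a) = 2 * Transposition.transpose 1 b a"
    by (auto simp: pair_exchange_def Transposition.transpose_def)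
qed

text \<open>If \<open>H\<close> alternates in its first multi-index and is invariant under exchanging pairs
  of positions, and swapping the first pair, in both multi-indices at once, then the endomorphism
  obtained by contracting all positions but the first is a multiple of the identity.\<close>

lemma contraction_eq_trace:
  fixes H :: "(nat \<Rightarrow> 'n::finite) \<Rightarrow> (nat \<Rightarrow> 'n) \<Rightarrow> real"
  assumes n: "CARD('n) = 2 * k" and k: "k \<ge> 1"
    and alt: "\<And>I'. I' \<in> multi (2 * k) \<Longrightarrow> alternating (2 * k) (\<lambda>I. H I I')"
    and swap: "\<And>I I'. I \<in> multi (2 * k) \<Longrightarrow> I' \<in> multi (2 * k) \<Longrightarrow>
      H (I \<circ> Transposition.transpose 1 2) (I' \<circ> Transposition.transpose 1 2) = H I I'"
    and exch: "\<And>b I I'. b \<in> {1..k} \<Longrightarrow> I \<in> multi (2 * k) \<Longrightarrow> I' \<in> multi (2 * k) \<Longrightarrow>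
      H (I \<circ> pair_exchange b) (I' \<circ> pair_exchange b) = H I I'"
  shows "real (2 * k) * (\<Sum>I\<in>multi1 (2 * k) m. H I (I(1 := l)))
    = (if l = m then (\<Sum>I\<in>multi (2 * k). H I I) else 0)"
proof -
  let ?n = "2 * k"
  \<comment> \<open>The component of the endomorphism obtained by leaving position \<open>a\<close> free instead of the
    first one.\<close>
  define T where "T a = (\<Sum>I | I \<in> multi ?n \<and> I a = m. H I (I(a := l)))" for a
  have T_eq: "T (\<tau> c) = T c"
    if \<tau>: "\<tau> permutes {1..?n}" and c: "c \<in> {1..?n}"
      and inv: "\<And>I I'. I \<in> multi ?n \<Longrightarrow> I' \<in> multi ?n \<Longrightarrow> H (I \<circ> \<tau>) (I' \<circ> \<tau>) = H I I'" for \<tau> c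
    unfolding T_def
  proof (rule sum.reindex_bij_witness[of _ "\<lambda>I. I \<circ> inv \<tau>" "\<lambda>I. I \<circ> \<tau>"])
    fix I assume I: "I \<in> {I \<in> multi ?n. I (\<tau> c) = m}"
    have upd: "(I \<circ> \<tau>)(c := l) = I(\<tau> c := l) \<circ> \<tau>"
      using permutes_inj[OF \<tau>] by (auto simp: fun_eq_iff inj_eq)
    have "\<tau> c \<in> {1..?n}"
      using permutes_in_image[OF \<tau>] c by blast
    then show "H (I \<circ> \<tau>) ((I \<circ> \<tau>)(c := l)) = H I (I(\<tau> c := l))"
      unfolding upd using I by (intro inv multi_upd) auto
  qed (use \<tau> in \<open>auto simp: comp_assoc permutes_inv_o multi_comp permutes_inv permutes_inverses\<close>)
  \<comment> \<open>Swapping the first pair and exchanging pairs moves the first position to any other one.\<close>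
  have T2: "T 2 = T 1"
    using T_eq[of "Transposition.transpose 1 2" 1] swap k by (simp add: permutes_swap_id)
  have T1: "T a = T 1" if a: "a \<in> {1..?n}" for a
  proof -
    obtain b where b: "b \<in> {1..k}" "a = 2 * b - 1 \<or> a = 2 * b"
    proof (cases "even a")
      case True
      then show ?thesis using that[of "a div 2"] a by auto
    next
      case False
      then obtain c where "a = 2 * c + 1" by (elim oddE)
      then show ?thesis using that[of "Suc c"] a by auto
    qed
    have "pair_exchange b 1 = 2 * b - 1" "pair_exchange b 2 = 2 * b"
      using pair_exchange_apply[of b 1] b by auto
    moreover have "T (pair_exchange b 1) = T 1" "T (pair_exchange b 2) = T 2"
      using T_eq[OF pair_exchange_permutes[OF b(1)] _ exch[OF b(1)]] k by auto
    ultimately show ?thesis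
      using b(2) T2 by auto
  qed
  \<comment> \<open>The exchange identity writes $\delta_m^l$ times the full contraction as the sum of the $n$
    equal numbers \<open>T a\<close>.\<close>
  have "(if l = m then (\<Sum>I\<in>multi ?n. H I I) else 0)
      = (\<Sum>I\<in>multi ?n. \<Sum>a\<in>{1..?n}. if I a = l then H (I(a := m)) I else 0)"
    using alternating_exchange[OF alt n] by (simp add: n)
  also have "\<dots> = (\<Sum>a\<in>{1..?n}. \<Sum>I\<in>multi ?n. if I a = l then H (I(a := m)) I else 0)"
    by (rule sum.swap)
  also have "\<dots> = (\<Sum>a\<in>{1..?n}. T a)"
  proof (rule sum.cong[OF refl])
    fix a assume a: "a \<in> {1..?n}"
    have "(\<Sum>I\<in>multi ?n. if I a = l then H (I(a := m)) I else 0)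
        = (\<Sum>I | I \<in> multi ?n \<and> I a = l. H (I(a := m)) I)"
      by (rule sum.inter_filter[symmetric]) simp
    also have "\<dots> = T a"
      unfolding T_def
    proof (rule sum.reindex_bij_witness[of _ "\<lambda>I. I(a := l)" "\<lambda>I. I(a := m)"])
      fix I assume I: "I \<in> {I \<in> multi ?n. I a = l}"
      then have upd: "I(a := m, a := l) = I" by auto
      show "I(a := m, a := l) = I" by (rule upd)
      show "I(a := m) \<in> {I \<in> multi ?n. I a = m}" using I by (simp add: multi_upd[OF a])
      show "H (I(a := m)) (I(a := m, a := l)) = H (I(a := m)) I" by (simp only: upd)
    next
      fix I assume I: "I \<in> {I \<in> multi ?n. I a = m}"
      then show "I(a := l, a := m) = I" by auto
      show "I(a := l) \<in> {I \<in> multi ?n. I a = l}" using I by (simp add: multi_upd[OF a])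
    qed
    finally show "(\<Sum>I\<in>multi ?n. if I a = l then H (I(a := m)) I else 0) = T a" .
  qed
  also have "\<dots> = (\<Sum>a\<in>{1..?n}. T 1)"
    using T1 by (rule sum.cong[OF refl])
  also have "\<dots> = real ?n * T 1"
    by simp
  finally show ?thesis
    by (simp add: T_def multi1_def)
qed

lemma gdelta_comp_lower:
  assumes "\<tau> permutes {1..m}"
  shows "gdelta m (I \<circ> \<tau>) J = of_int (sign \<tau>) * gdelta m I J"
proof -
  have sgn: "sign (\<sigma> \<circ> \<tau>) = sign \<tau> * sign \<sigma>" if "\<sigma> permutes {1..m}" for \<sigma>
    using that assms by (simp add: sign_compose permutes_imp_permutation[of "{1..m}"])
  have "gdelta m (I \<circ> \<tau>) J = (\<Sum>\<sigma> | \<sigma> permutes {1..m}. of_int (sign (\<sigma> \<circ> \<tau>)) *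
      (\<Prod>a\<in>{1..m}. if (I \<circ> \<tau>) a = J ((\<sigma> \<circ> \<tau>) a) then 1 else 0))"
    unfolding gdelta_def by (rule sum_permutations_compose_right[OF assms])
  also have "\<dots> = (\<Sum>\<sigma> | \<sigma> permutes {1..m}. of_int (sign \<tau>) * (of_int (sign \<sigma>) *
      (\<Prod>a\<in>{1..m}. if I a = J (\<sigma> a) then 1 else 0)))"
  proof (rule sum.cong[OF refl])
    fix \<sigma> assume "\<sigma> \<in> {\<sigma>. \<sigma> permutes {1..m}}"
    then show "real_of_int (sign (\<sigma> \<circ> \<tau>)) *
        (\<Prod>a\<in>{1..m}. if (I \<circ> \<tau>) a = J ((\<sigma> \<circ> \<tau>) a) then 1 else 0)
      = of_int (sign \<tau>) * (of_int (sign \<sigma>) * (\<Prod>a\<in>{1..m}. if I a = J (\<sigma> a) then 1 else 0))"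
      using prod.permute[OF assms, of "\<lambda>a. if I a = J (\<sigma> a) then 1 else (0::real)", unfolded comp_def]
      by (simp add: sgn)
  qed
  finally show ?thesis
    by (simp add: gdelta_def sum_distrib_left)
qed

lemma gdelta_comp_upper:
  assumes "\<tau> permutes {1..m}"
  shows "gdelta m I (J \<circ> \<tau>) = of_int (sign \<tau>) * gdelta m I J"
proof -
  have sgn: "sign (\<tau> \<circ> \<sigma>) = sign \<tau> * sign \<sigma>" if "\<sigma> permutes {1..m}" for \<sigma>
    using that assms by (simp add: sign_compose permutes_imp_permutation[of "{1..m}"])
  have "gdelta m I J = (\<Sum>\<sigma> | \<sigma> permutes {1..m}. of_int (sign (\<tau> \<circ> \<sigma>)) *
      (\<Prod>a\<in>{1..m}. if I a = J ((\<tau> \<circ> \<sigma>) a) then 1 else 0))"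
    unfolding gdelta_def by (rule setum_permutations_compose_left[OF assms])
  also have "\<dots> = of_int (sign \<tau>) * gdelta m I (J \<circ> \<tau>)"
    unfolding gdelta_def sum_distrib_left by (intro sum.cong refl) (simp add: sgn)
  finally show ?thesis
    by (simp add: mult.assoc[symmetric] of_int_mult[symmetric] del: of_int_mult)
qed

lemma gdelta_comp_both: "\<tau> permutes {1..m} \<Longrightarrow> gdelta m (I \<circ> \<tau>) (J \<circ> \<tau>) = gdelta m I J"
  by (simp add: gdelta_comp_lower gdelta_comp_upper mult.assoc[symmetric]
      of_int_mult[symmetric] del: of_int_mult)

lemma alternating_gdelta: "alternating n (\<lambda>I. gdelta n I J)"
  unfolding alternating_def
  by (auto simp: gdelta_comp_lower permutes_swap_id sign_swap_id)

lemma alternating_comp_pair_exchange: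
  assumes e: "alternating (2 * k) e" and b: "b \<in> {1..k}" and I: "I \<in> multi (2 * k)"
  shows "e (I \<circ> pair_exchange b) = e I"
proof (cases "b = 1")
  case True
  then show ?thesis by (simp add: pair_exchange_def)
next
  case False
  let ?t = "Transposition.transpose 1 (2 * b - 1)"
  have "?t permutes {1..2 * k}"
    using b by (intro permutes_swap_id) auto
  then have "e (I \<circ> ?t \<circ> Transposition.transpose 2 (2 * b)) = - e (I \<circ> ?t)"
    using b False by (intro alternatingD[OF e] multi_comp[OF _ I]) auto
  also have "e (I \<circ> ?t) = - e I"
    using b False by (intro alternatingD[OF e I]) auto
  also have "- (- e I) = e I" by simp
  finally show ?thesis
    by (simp only: pair_exchange_def comp_assoc)
qed

text \<open>In a product with one factor \<open>w a\<close> for each pair of positions, exchanging two pairs amounts to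
  exchanging the labels of the two factors.\<close>

lemma prod_pairs_exchange:
  fixes w :: "nat \<Rightarrow> 'i \<Rightarrow> 'i \<Rightarrow> real"
  assumes "b \<in> {1..k}"
  shows "(\<Prod>a\<in>{1..k}. w (Transposition.transpose 1 b a)
      ((K \<circ> pair_exchange b) (2*a-1)) ((K \<circ> pair_exchange b) (2*a)))
    = (\<Prod>a\<in>{1..k}. w a (K (2*a-1)) (K (2*a)))"
proof -
  have "Transposition.transpose 1 b permutes {1..k}"
    using assms by (intro permutes_swap_id) auto
  from prod.permute[OF this, of "\<lambda>a. w a (K (2*a-1)) (K (2*a))"]
  have "(\<Prod>a\<in>{1..k}. w a (K (2*a-1)) (K (2*a)))
    = (\<Prod>a\<in>{1..k}. w (Transposition.transpose 1 b a)
        (K (2 * Transposition.transpose 1 b a - 1)) (K (2 * Transposition.transpose 1 b a)))"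
    by (simp only: comp_def)
  also have "\<dots> = (\<Prod>a\<in>{1..k}. w (Transposition.transpose 1 b a)
      ((K \<circ> pair_exchange b) (2*a-1)) ((K \<circ> pair_exchange b) (2*a)))"
  proof (rule prod.cong[OF refl])
    fix a assume "a \<in> {1..k}"
    then have "a \<ge> 1" "b \<ge> 1" using assms by auto
    then show "w (Transposition.transpose 1 b a)
        (K (2 * Transposition.transpose 1 b a - 1)) (K (2 * Transposition.transpose 1 b a))
      = w (Transposition.transpose 1 b a)
        ((K \<circ> pair_exchange b) (2*a-1)) ((K \<circ> pair_exchange b) (2*a))"
      by (simp only: comp_apply pair_exchange_apply)
  qed
  finally show ?thesis by simp
qed

lemma prod_pairs_split:
  fixes w :: "nat \<Rightarrow> real"
  assumes "k \<ge> 1"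
  shows "(\<Prod>a\<in>{1..k}. w a) = w 1 * (\<Prod>a\<in>{2..k}. w a)"
  using prod.atLeast_Suc_atMost[OF assms, of w] by (simp add: numeral_2_eq_2)

section \<open>The Pfaffian and the one-form \<open>\<xi>\<close>\<close>

context conformal_chart
begin

lemma cotton_ddu_gh:
  assumes x: "x \<in> S" and n: "CARD('n) > 2"
  shows "cotton_ddu gh x i j k
    = exp (- 2 * u x) * (cotton_ddu g x i j k + (\<Sum>l\<in>UNIV. du x l * weyl_dduu g x i j l k))"
proof -
  have "(\<Sum>a\<in>UNIV. ginv g x k a * (\<Sum>l\<in>UNIV. grad x l * weyl g x i j l a))
      = (\<Sum>a\<in>UNIV. \<Sum>l\<in>UNIV. \<Sum>p\<in>UNIV. du x p * (ginv g x p l * ginv g x k a * weyl g x i j l a))"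
    unfolding grad_def sum_distrib_left sum_distrib_right
    by (intro sum.cong refl) (simp add: ginv_sym[OF x] mult_ac)
  also have "\<dots> = (\<Sum>p\<in>UNIV. \<Sum>l\<in>UNIV. \<Sum>a\<in>UNIV. du x p * (ginv g x p l * ginv g x k a * weyl g x i j l a))"
    by (subst (2) sum.swap, subst sum.swap, intro sum.cong refl sum.swap)
  also have "\<dots> = (\<Sum>l\<in>UNIV. du x l * weyl_dduu g x i j l k)"
    by (simp add: weyl_dduu_def sum_distrib_left)
  finally have 1: "(\<Sum>a\<in>UNIV. ginv g x k a * (\<Sum>l\<in>UNIV. grad x l * weyl g x i j l a)) = \<dots>" .
  have "cotton_ddu gh x i j k = exp (- 2 * u x) * (cotton_ddu g x i j k
      + (\<Sum>a\<in>UNIV. ginv g x k a * (\<Sum>l\<in>UNIV. grad x l * weyl g x i j l a)))"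
    unfolding cotton_ddu_def cotton_gh[OF x n] ginv_gh[OF x] sum.distrib[symmetric]
      sum_distrib_left[of "exp (- 2 * u x)"]
    by (intro sum.cong refl) (simp add: algebra_simps)
  then show ?thesis unfolding 1 .
qed

lemma cotton_dud_gh:
  assumes x: "x \<in> S" and n: "CARD('n) > 2"
  shows "cotton_dud gh x i j k
    = exp (- 2 * u x) * (cotton_dud g x i j k + (\<Sum>l\<in>UNIV. grad x l * weyl_dudd g x i j l k))"
proof -
  have "(\<Sum>a\<in>UNIV. ginv g x j a * (\<Sum>l\<in>UNIV. grad x l * weyl g x i a l k))
      = (\<Sum>a\<in>UNIV. \<Sum>l\<in>UNIV. grad x l * (ginv g x j a * weyl g x i a l k))"
    by (simp add: sum_distrib_left mult_ac)
  also have "\<dots> = (\<Sum>l\<in>UNIV. grad x l * weyl_dudd g x i j l k)"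
    by (subst sum.swap) (simp add: weyl_dudd_def sum_distrib_left)
  finally have 1: "(\<Sum>a\<in>UNIV. ginv g x j a * (\<Sum>l\<in>UNIV. grad x l * weyl g x i a l k)) = \<dots>" .
  have "cotton_dud gh x i j k = exp (- 2 * u x) * (cotton_dud g x i j k
      + (\<Sum>a\<in>UNIV. ginv g x j a * (\<Sum>l\<in>UNIV. grad x l * weyl g x i a l k)))"
    unfolding cotton_dud_def cotton_gh[OF x n] ginv_gh[OF x] sum.distrib[symmetric]
      sum_distrib_left[of "exp (- 2 * u x)"]
    by (intro sum.cong refl) (simp add: algebra_simps)
  then show ?thesis unfolding 1 .
qed

lemma Pf_gh:
  assumes x: "x \<in> S" and n: "CARD('n) > 2"
  shows "Pf k gh x = exp (- (2 * real k) * u x) * Pf k g x"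
proof -
  have "exp (- (2 * real k) * u x) = exp (- 2 * u x) ^ k"
    by (simp add: exp_of_nat_mult[symmetric] mult_ac)
  then show ?thesis
    unfolding Pf_def weyl_dduu_gh[OF x n] prod.distrib sum_distrib_left
    by (simp add: mult_ac)
qed

lemma smooth_Pf: "smooth_on S (Pf k g)"
  unfolding Pf_def by (intro smooth_intros open_S)

lemma pd_exp_scaled:
  assumes x: "x \<in> S" and f: "\<And>y. y \<in> S \<Longrightarrow> fh y = exp (- c * u y) * f y"
    and d: "f differentiable (at x)"
  shows "pd i fh x = exp (- c * u x) * (pd i f x - c * du x i * f x)"
proof -
  have "pd i fh x = pd i (\<lambda>y. exp (- c * u y) * f y) x"
    by (rule pd_cong_open[OF open_S x f])
  also have "\<dots> = pd i (\<lambda>y. exp (- c * u y)) x * f x + exp (- c * u x) * pd i f x"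
    by (intro pd_mult diff_at smooth_intros open_S smooth_u x d)
  also have "pd i (\<lambda>y. exp (- c * u y)) x = - c * du x i * exp (- c * u x)"
    by (intro pd_exp_mult diff_at smooth_u x)
  finally show ?thesis by (simp add: algebra_simps)
qed

lemma xi_gh:
  assumes x: "x \<in> S" and k: "k \<ge> 2" and n: "CARD('n) = 2 * k"
  shows "xi k gh x i = exp (- (2 * real k) * u x) * xi k g x i"
proof -
  have n2: "CARD('n) > 2" using k n by simp
  let ?W = "weyl_dduu g x"
  let ?E = "exp (- 2 * u x)"
  \<comment> \<open>Up to the factor $1/k!$, \<open>H I I\<close> is the contribution of \<open>I\<close> to the Pfaffian, and
    \<open>H I (I(1 := l))\<close> is the one to the coefficient of $\nabla_l u$ in the term that the change of the Cotton tensor contributes.\<close>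
  define H where "H I I' = (\<Sum>J\<in>multi (2*k). gdelta (2*k) I J *
    (\<Prod>a\<in>{1..k}. ?W (J (2*a-1)) (J (2*a)) (I' (2*a-1)) (I' (2*a))))" for I I' :: "nat \<Rightarrow> 'n"
  have alt: "alternating (2 * k) (\<lambda>I. H I I')" for I'
    unfolding alternating_def
  proof (intro ballI impI)
    fix I :: "nat \<Rightarrow> 'n" and a b
    assume "I \<in> multi (2 * k)" "a \<in> {1..2 * k}" "b \<in> {1..2 * k}" "a \<noteq> b"
    note alternatingD[OF alternating_gdelta this]
    then show "H (I \<circ> Transposition.transpose a b) I' = - H I I'"
      unfolding H_def by (simp only: sum_negf[symmetric] mult_minus_left)
  qed
  have inv: "H (I \<circ> \<tau>) (I' \<circ> \<tau>) = H I I'"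
    if \<tau>: "\<tau> permutes {1..2 * k}"
      and W: "\<And>J. (\<Prod>a\<in>{1..k}. ?W ((J \<circ> \<tau>) (2*a-1)) ((J \<circ> \<tau>) (2*a)) ((I' \<circ> \<tau>) (2*a-1)) ((I' \<circ> \<tau>) (2*a)))
        = (\<Prod>a\<in>{1..k}. ?W (J (2*a-1)) (J (2*a)) (I' (2*a-1)) (I' (2*a)))" for I I' \<tau>
    unfolding H_def
    by (subst sum_multi_permute[OF \<tau>]) (simp only: W gdelta_comp_both[OF \<tau>])
  have trace: "real (2 * k) * (\<Sum>I\<in>multi1 (2 * k) m. H I (I(1 := l)))
      = (if l = m then (\<Sum>I\<in>multi (2 * k). H I I) else 0)" for l m
  proof (rule contraction_eq_trace[OF n])
    show "1 \<le> k" using k by simp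
    show "alternating (2 * k) (\<lambda>I. H I I')" for I' by (rule alt)
    show "H (I \<circ> Transposition.transpose 1 2) (I' \<circ> Transposition.transpose 1 2) = H I I'" for I I'
    proof (rule inv)
      show "Transposition.transpose 1 2 permutes {1..2 * k}"
        using k by (intro permutes_swap_id) auto
      let ?t = "Transposition.transpose 1 2 :: nat \<Rightarrow> nat"
      have "?W ((J \<circ> ?t) (2*a-1)) ((J \<circ> ?t) (2*a)) ((I' \<circ> ?t) (2*a-1)) ((I' \<circ> ?t) (2*a))
        = ?W (J (2*a-1)) (J (2*a)) (I' (2*a-1)) (I' (2*a))" if a: "a \<in> {1..k}" for a J
      proof (cases "a = 1")
        case True
        have "?W (J 2) (J 1) (I' 2) (I' 1) = ?W (J 1) (J 2) (I' 1) (I' 2)"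
          using weyl_dduu_skew[OF x] by (metis minus_minus)
        then show ?thesis using True by simp
      next
        case False
        then have "?t (2*a-1) = 2*a-1" "?t (2*a) = 2*a"
          using a by (auto intro!: transpose_apply_other)
        then show ?thesis by (simp only: comp_apply)
      qed
      then show "(\<Prod>a\<in>{1..k}. ?W ((J \<circ> ?t) (2*a-1)) ((J \<circ> ?t) (2*a)) ((I' \<circ> ?t) (2*a-1)) ((I' \<circ> ?t) (2*a)))
        = (\<Prod>a\<in>{1..k}. ?W (J (2*a-1)) (J (2*a)) (I' (2*a-1)) (I' (2*a)))" for J
        by (rule prod.cong[OF refl])
    qed
    show "H (I \<circ> pair_exchange b) (I' \<circ> pair_exchange b) = H I I'" if b: "b \<in> {1..k}" for b I I'
    proof (rule inv[OF pair_exchange_permutes[OF b]])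
      show "(\<Prod>a\<in>{1..k}. ?W ((J \<circ> pair_exchange b) (2*a-1)) ((J \<circ> pair_exchange b) (2*a))
          ((I' \<circ> pair_exchange b) (2*a-1)) ((I' \<circ> pair_exchange b) (2*a)))
        = (\<Prod>a\<in>{1..k}. ?W (J (2*a-1)) (J (2*a)) (I' (2*a-1)) (I' (2*a)))" for J
        using prod_pairs_exchange[OF b, of "\<lambda>_ p q. ?W (fst p) (fst q) (snd p) (snd q)" "\<lambda>a. (J a, I' a)"]
        by simp
    qed
  qed
  define Q where "Q I J = (\<Prod>a\<in>{2..k}. ?W (J (2*a-1)) (J (2*a)) (I (2*a-1)) (I (2*a)))"
    for I J :: "nat \<Rightarrow> 'n"
  have H1: "H I (I(1 := l)) = (\<Sum>J\<in>multi (2*k). gdelta (2*k) I J * ?W (J 1) (J 2) l (I 2) * Q I J)" for I l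
  proof -
    have "(\<Prod>a\<in>{1..k}. ?W (J (2*a-1)) (J (2*a)) ((I(1 := l)) (2*a-1)) ((I(1 := l)) (2*a)))
      = ?W (J 1) (J 2) l (I 2) * Q I J" for J
    proof -
      have "(\<Prod>a\<in>{2..k}. ?W (J (2*a-1)) (J (2*a)) ((I(1 := l)) (2*a-1)) ((I(1 := l)) (2*a))) = Q I J"
        unfolding Q_def by (rule prod.cong[OF refl]) auto
      then show ?thesis
        using k by (subst prod_pairs_split) auto
    qed
    then show ?thesis unfolding H_def by (simp add: mult.assoc)
  qed
  have tr: "(\<Sum>I\<in>multi (2 * k). H I I) = fact k * Pf k g x"
    unfolding H_def Pf_def by simp
  have Eexp: "exp (- (2 * real k) * u x) = ?E * ?E ^ card {2..k}"
  proof -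
    have "?E * ?E ^ card {2..k} = ?E ^ k"
      using k by (simp add: power_Suc[symmetric] Suc_diff_le del: power_Suc)
    then show ?thesis
      by (simp add: exp_of_nat_mult[symmetric] mult_ac)
  qed
  have "(\<Sum>I\<in>multi1 (2*k) i. \<Sum>J\<in>multi (2*k). gdelta (2*k) I J * cotton_ddu gh x (J 1) (J 2) (I 2) *
        (\<Prod>a\<in>{2..k}. weyl_dduu gh x (J (2*a-1)) (J (2*a)) (I (2*a-1)) (I (2*a))))
      = exp (- (2 * real k) * u x) * (\<Sum>I\<in>multi1 (2*k) i. \<Sum>J\<in>multi (2*k).
          gdelta (2*k) I J * cotton_ddu g x (J 1) (J 2) (I 2) * Q I J
          + (\<Sum>l\<in>UNIV. du x l * (gdelta (2*k) I J * ?W (J 1) (J 2) l (I 2) * Q I J)))"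
    unfolding weyl_dduu_gh[OF x n2] cotton_ddu_gh[OF x n2] prod.distrib prod_constant Q_def[symmetric]
      Eexp sum_distrib_left[of "?E * ?E ^ card {2..k}"]
    by (intro sum.cong refl) (simp add: distrib_left distrib_right sum_distrib_left sum_distrib_right mult_ac)
  also have "(\<Sum>I\<in>multi1 (2*k) i. \<Sum>J\<in>multi (2*k).
          gdelta (2*k) I J * cotton_ddu g x (J 1) (J 2) (I 2) * Q I J
          + (\<Sum>l\<in>UNIV. du x l * (gdelta (2*k) I J * ?W (J 1) (J 2) l (I 2) * Q I J)))
      = (\<Sum>I\<in>multi1 (2*k) i. \<Sum>J\<in>multi (2*k). gdelta (2*k) I J * cotton_ddu g x (J 1) (J 2) (I 2) * Q I J)
        + (\<Sum>I\<in>multi1 (2*k) i. \<Sum>l\<in>UNIV. du x l * H I (I(1 := l)))"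
  proof -
    have "(\<Sum>J\<in>multi (2*k). \<Sum>l\<in>UNIV. du x l * (gdelta (2*k) I J * ?W (J 1) (J 2) l (I 2) * Q I J))
      = (\<Sum>l\<in>UNIV. du x l * H I (I(1 := l)))" for I
      unfolding H1 sum_distrib_left by (rule sum.swap)
    then show ?thesis by (simp only: sum.distrib)
  qed
  also have "(\<Sum>I\<in>multi1 (2*k) i. \<Sum>l\<in>UNIV. du x l * H I (I(1 := l))) = du x i * (fact k * Pf k g x) / (2 * real k)"
  proof -
    have "(\<Sum>I\<in>multi1 (2*k) i. \<Sum>l\<in>UNIV. du x l * H I (I(1 := l)))
        = (\<Sum>l\<in>UNIV. du x l * (\<Sum>I\<in>multi1 (2*k) i. H I (I(1 := l))))"
      unfolding sum_distrib_left by (rule sum.swap)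
    also have "\<dots> = (\<Sum>l\<in>UNIV. du x l * (if l = i then 1 else 0) * (fact k * Pf k g x / (2 * real k)))"
    proof (intro sum.cong refl)
      show "du x l * (\<Sum>I\<in>multi1 (2*k) i. H I (I(1 := l)))
        = du x l * (if l = i then 1 else 0) * (fact k * Pf k g x / (2 * real k))" for l
        using trace[of l i] k unfolding tr by (cases "l = i") (auto simp: field_simps)
    qed
    finally show ?thesis
      by (simp only: sum_distrib_right[symmetric] sum_delta_mult) simp
  qed
  finally have main: "(\<Sum>I\<in>multi1 (2*k) i. \<Sum>J\<in>multi (2*k). gdelta (2*k) I J * cotton_ddu gh x (J 1) (J 2) (I 2) *
        (\<Prod>a\<in>{2..k}. weyl_dduu gh x (J (2*a-1)) (J (2*a)) (I (2*a-1)) (I (2*a))))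
      = exp (- (2 * real k) * u x) * ((\<Sum>I\<in>multi1 (2*k) i. \<Sum>J\<in>multi (2*k).
          gdelta (2*k) I J * cotton_ddu g x (J 1) (J 2) (I 2) * Q I J)
        + du x i * (fact k * Pf k g x) / (2 * real k))" .
  have dPf: "pd i (Pf k gh) x = exp (- (2 * real k) * u x) * (pd i (Pf k g) x - 2 * real k * du x i * Pf k g x)"
    by (rule pd_exp_scaled[OF x Pf_gh[OF _ n2] diff_at[OF smooth_Pf x]])
  show ?thesis
    unfolding xi_def main dPf Q_def[symmetric] using k n by (simp add: field_simps)
qed

end

section \<open>The volume form and the one-form \<open>\<rho>\<close>\<close>

lemma det_scaleR:
  fixes M :: "real^'n::finite^'n"
  shows "det (c *\<^sub>R M) = c ^ CARD('n) * det M"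
  unfolding det_def by (simp add: prod.distrib sum_distrib_left mult_ac)

lemma (in metric_chart) alternating_vol_up: "alternating CARD('n) (vol_up s g x)"
  unfolding alternating_def
proof (intro ballI impI)
  fix I :: "nat \<Rightarrow> 'n" and a b assume ab: "a \<in> {1..CARD('n)}" "b \<in> {1..CARD('n)}" "a \<noteq> b"
  let ?t = "Transposition.transpose a b"
  have t: "?t permutes {1..CARD('n)}" using ab by (intro permutes_swap_id)
  have "vol_up s g x (I \<circ> ?t)
      = (\<Sum>L\<in>multi CARD('n). vol s g x (L \<circ> ?t) * (\<Prod>a\<in>{1..CARD('n)}. ginv g x ((I \<circ> ?t) a) ((L \<circ> ?t) a)))"
    unfolding vol_up_def by (rule sum_multi_permute[OF t])
  also have "\<dots> = (\<Sum>L\<in>multi CARD('n). - (vol s g x L * (\<Prod>a\<in>{1..CARD('n)}. ginv g x (I a) (L a))))"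
  proof (intro sum.cong refl)
    fix L :: "nat \<Rightarrow> 'n"
    have "vol s g x (L \<circ> ?t) = - vol s g x L"
      unfolding vol_def gdelta_comp_lower[OF t] using ab by (simp add: sign_swap_id)
    moreover have "(\<Prod>a\<in>{1..CARD('n)}. ginv g x ((I \<circ> ?t) a) ((L \<circ> ?t) a)) = (\<Prod>a\<in>{1..CARD('n)}. ginv g x (I a) (L a))"
      using prod.permute[OF t, of "\<lambda>a. ginv g x (I a) (L a)", unfolded comp_def] by simp
    ultimately show "vol s g x (L \<circ> ?t) * (\<Prod>a\<in>{1..CARD('n)}. ginv g x ((I \<circ> ?t) a) ((L \<circ> ?t) a))
      = - (vol s g x L * (\<Prod>a\<in>{1..CARD('n)}. ginv g x (I a) (L a)))"
      by simp
  qed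
  finally show "vol_up s g x (I \<circ> ?t) = - vol_up s g x I"
    by (simp add: vol_up_def sum_negf)
qed

lemma (in metric_chart) vol_mixed_eq_lower_vol_up:
  assumes x: "x \<in> S"
  shows "vol_mixed s g x I = (\<Sum>q\<in>UNIV. g x $ I 1 $ q * vol_up s g x (I(1 := q)))"
proof -
  let ?N = "CARD('n)"
  let ?P = "\<lambda>L. (\<Prod>a\<in>{2..?N}. ginv g x (I a) (L a))"
  have P: "(\<Prod>a\<in>{1..?N}. ginv g x ((I(1 := q)) a) (L a)) = ginv g x q (L 1) * ?P L" for q L
  proof -
    have "(\<Prod>a\<in>{2..?N}. ginv g x ((I(1 := q)) a) (L a)) = ?P L"
      by (rule prod.cong[OF refl]) auto
    then show ?thesis
      using zero_less_card_finite[where 'a = 'n] by (subst prod_pairs_split) auto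
  qed
  have "(\<Sum>q\<in>UNIV. g x $ I 1 $ q * vol_up s g x (I(1 := q)))
      = (\<Sum>q\<in>UNIV. \<Sum>L\<in>multi ?N. g x $ I 1 $ q * ginv g x q (L 1) * (vol s g x L * ?P L))"
    unfolding vol_up_def P sum_distrib_left by (intro sum.cong refl) (simp add: mult_ac)
  also have "\<dots> = (\<Sum>L\<in>multi ?N. (\<Sum>q\<in>UNIV. g x $ I 1 $ q * ginv g x q (L 1)) * (vol s g x L * ?P L))"
    unfolding sum_distrib_right by (rule sum.swap)
  also have "\<dots> = (\<Sum>L\<in>multi ?N. if L 1 = I 1 then vol s g x L * ?P L else 0)"
    unfolding sum_g_ginv[OF x] by (intro sum.cong refl) auto
  also have "\<dots> = vol_mixed s g x I"
    unfolding vol_mixed_def multi1_def by (rule sum.inter_filter[symmetric]) simp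
  finally show ?thesis by simp
qed

lemma sum_multi1_reindex:
  fixes f :: "(nat \<Rightarrow> 'n::finite) \<Rightarrow> real"
  assumes "n \<ge> 1"
  shows "(\<Sum>I\<in>multi1 n i. f (I(1 := q))) = (\<Sum>I\<in>multi1 n q. f I)"
proof (rule sum.reindex_bij_witness[of _ "\<lambda>I. I(1 := i)" "\<lambda>I. I(1 := q)"])
  have "1 \<in> {1..n}" using assms by simp
  note upd = multi_upd[OF this]
  fix I :: "nat \<Rightarrow> 'n"
  show "I(1 := q, 1 := i) = I" "I(1 := q) \<in> multi1 n q" if "I \<in> multi1 n i"
    using that upd unfolding multi1_iff by auto
  show "I(1 := i, 1 := q) = I" "I(1 := i) \<in> multi1 n i" if "I \<in> multi1 n q"
    using that upd unfolding multi1_iff by auto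
qed simp

text \<open>The contraction
  $\Phi_{s_1\cdots s_k}^{t_1\cdots t_k} W_{t_1}{}^{s_1}{}_{i_1i_2} \cdots W_{t_k}{}^{s_k}{}_{i_{2k-1}i_{2k}}$,
  which is paired with the volume form in $p_\Phi$.\<close>

definition Phi_weyl ::
  "nat \<Rightarrow> ((nat \<Rightarrow> 'n) \<Rightarrow> (nat \<Rightarrow> 'n) \<Rightarrow> real) \<Rightarrow> (real^'n \<Rightarrow> real^'n^'n) \<Rightarrow> real^'n::finite
    \<Rightarrow> (nat \<Rightarrow> 'n) \<Rightarrow> real" where
  "Phi_weyl k \<Phi> g x I = (\<Sum>S\<in>multi k. \<Sum>T\<in>multi k. \<Phi> S T *
     (\<Prod>a\<in>{1..k}. weyl_dudd g x (T a) (S a) (I (2*a-1)) (I (2*a))))"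

lemma p_poly_eq:
  "p_poly k \<Phi> s g x = 1 / fact (2*k) * (\<Sum>I\<in>multi (2*k). vol_up s g x I * Phi_weyl k \<Phi> g x I)"
  unfolding p_poly_def Phi_weyl_def by (simp add: sum_distrib_left mult.assoc)

lemma (in metric_chart) Phi_weyl_swap:
  assumes x: "x \<in> S" and k: "k \<ge> 1"
  shows "Phi_weyl k \<Phi> g x (I \<circ> Transposition.transpose 1 2) = - Phi_weyl k \<Phi> g x I"
proof -
  let ?t = "Transposition.transpose 1 2 :: nat \<Rightarrow> nat"
  have "(\<Prod>a\<in>{1..k}. weyl_dudd g x (T a) (R a) ((I \<circ> ?t) (2*a-1)) ((I \<circ> ?t) (2*a)))
    = - (\<Prod>a\<in>{1..k}. weyl_dudd g x (T a) (R a) (I (2*a-1)) (I (2*a)))" for R T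
  proof -
    have "?t (2*a-1) = 2*a-1" "?t (2*a) = 2*a" if "a \<in> {2..k}" for a
      using that by (auto intro!: transpose_apply_other)
    then have "(\<Prod>a\<in>{2..k}. weyl_dudd g x (T a) (R a) ((I \<circ> ?t) (2*a-1)) ((I \<circ> ?t) (2*a)))
      = (\<Prod>a\<in>{2..k}. weyl_dudd g x (T a) (R a) (I (2*a-1)) (I (2*a)))"
      by (intro prod.cong refl) (simp only: comp_apply)
    then show ?thesis
      using weyl_dudd_skew[OF x, of "T 1" "R 1" "I 2" "I 1"]
      by (simp only: prod_pairs_split[OF k]) simp
  qed
  then show ?thesis
    unfolding Phi_weyl_def by (simp add: sum_negf)
qed

lemma Phi_weyl_exchange:
  assumes \<Phi>: "homogeneous_invariant_polynomial k \<Phi>" and b: "b \<in> {1..k}"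
  shows "Phi_weyl k \<Phi> g x (I \<circ> pair_exchange b) = Phi_weyl k \<Phi> g x I"
proof -
  let ?\<pi> = "Transposition.transpose 1 b :: nat \<Rightarrow> nat"
  have \<pi>: "?\<pi> permutes {1..k}" using b by (intro permutes_swap_id) auto
  have inv: "\<Phi> (R \<circ> ?\<pi>) (T \<circ> ?\<pi>) = \<Phi> R T" for R T
    using \<Phi> \<pi> unfolding homogeneous_invariant_polynomial_def by metis
  have "Phi_weyl k \<Phi> g x (I \<circ> pair_exchange b) = (\<Sum>R\<in>multi k. \<Sum>T\<in>multi k. \<Phi> (R \<circ> ?\<pi>) (T \<circ> ?\<pi>) *
     (\<Prod>a\<in>{1..k}. weyl_dudd g x ((T \<circ> ?\<pi>) a) ((R \<circ> ?\<pi>) a)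
       ((I \<circ> pair_exchange b) (2*a-1)) ((I \<circ> pair_exchange b) (2*a))))"
    unfolding Phi_weyl_def by (subst sum_multi_permute[OF \<pi>], intro sum.cong refl sum_multi_permute[OF \<pi>])
  also have "\<dots> = Phi_weyl k \<Phi> g x I"
    unfolding Phi_weyl_def inv
    using prod_pairs_exchange[OF b, of "\<lambda>a. weyl_dudd g x (T a) (R a)" I for T R]
    by (simp only: comp_apply)
  finally show ?thesis .
qed

lemma (in metric_chart) smooth_Phi_weyl: "smooth_on S (\<lambda>x. Phi_weyl k \<Phi> g x I)"
  unfolding Phi_weyl_def by (intro smooth_intros open_S)

text \<open>An orientation sign is locally constant, and the determinant of the metric does not change its
  sign near a point. Therefore $p_\Phi$ is differentiable.\<close>

lemma (in metric_chart) p_poly_differentiable: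
  assumes x: "x \<in> S" and s: "continuous_on S s" "s ` S \<subseteq> {1, -1}"
  shows "p_poly k \<Phi> s g differentiable (at x)"
proof -
  define q where "q y = 1 / fact (2*k) * (\<Sum>I\<in>multi (2*k). (\<Sum>L\<in>multi CARD('n).
      gdelta CARD('n) L frame_index * (\<Prod>a\<in>{1..CARD('n)}. ginv g y (I a) (L a))) * Phi_weyl k \<Phi> g y I)" for y
  have q: "q differentiable (at x)"
    unfolding q_def by (intro diff_at smooth_intros open_S x smooth_Phi_weyl)
  have p_q: "p_poly k \<Phi> s g y = s y * sqrt \<bar>det (g y)\<bar> * q y" for y
    unfolding p_poly_eq q_def vol_up_def vol_def by (simp add: sum_distrib_left sum_distrib_right mult_ac)
  define D where "D y = sgn (det (g x)) * det (g y)" for y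
  have Dsm: "smooth_on S D"
    unfolding D_def by (intro smooth_intros open_S smooth_on_det smooth_g)
  have "det (g x) \<noteq> 0"
    using invertible_g[OF x] by (simp add: invertible_det_nz)
  then have D0: "D x > 0"
    unfolding D_def by (simp add: sgn_mult_self_eq sgn_real_def)
  have cont: "isCont s x" "isCont D x"
    using s(1) smooth_on_continuous[OF Dsm] open_S x by (auto simp: continuous_on_eq_continuous_at)
  have "\<forall>\<^sub>F y in nhds x. dist (s y) (s x) < 1"
    using cont(1) by (intro tendstoD) (auto simp: isCont_def tendsto_at_iff_tendsto_nhds)
  moreover have "\<forall>\<^sub>F y in nhds x. D y > 0"
    using cont(2) D0 by (intro order_tendstoD) (auto simp: isCont_def tendsto_at_iff_tendsto_nhds)
  moreover have "\<forall>\<^sub>F y in nhds x. y \<in> S"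
    using open_S x by (rule eventually_nhds_in_open)
  ultimately have "\<forall>\<^sub>F y in nhds x. s x * sqrt (D y) * q y = p_poly k \<Phi> s g y"
  proof eventually_elim
    case (elim y)
    have "s y = s x"
    proof -
      have "s y \<in> {1, -1}" "s x \<in> {1, -1}" using elim(3) s(2) x by blast+
      then show ?thesis using elim(1) by (auto simp: dist_real_def)
    qed
    moreover have "\<bar>det (g y)\<bar> = D y"
      using elim(2) unfolding D_def by (auto simp: sgn_real_def split: if_splits)
    ultimately show ?case by (simp add: p_q)
  qed
  then obtain U where U: "open U" "x \<in> U" "\<And>y. y \<in> U \<Longrightarrow> s x * sqrt (D y) * q y = p_poly k \<Phi> s g y"
    unfolding eventually_nhds by blast
  have "(\<lambda>y. sqrt (D y)) differentiable (at x)"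
  proof -
    have "(sqrt has_derivative (*) (inverse (sqrt (D x)) / 2)) (at (D x))"
      using DERIV_real_sqrt[OF D0] by (simp add: has_field_derivative_def)
    then show ?thesis
      using has_derivative_compose[OF has_derivative_pd[OF diff_at[OF Dsm x]]]
      unfolding differentiable_def by blast
  qed
  then have "(\<lambda>y. s x * sqrt (D y) * q y) differentiable (at x)"
    using q by (intro differentiable_mult) auto
  then show ?thesis
    using has_derivative_transform_within_open[OF _ U(1,2)] U(3) unfolding differentiable_def by blast
qed

context conformal_chart
begin

lemma vol_gh: "vol s gh x I = exp (real CARD('n) * u x) * vol s g x I"
proof -
  have "sqrt (exp (2 * u x) ^ CARD('n)) = exp (real CARD('n) * u x)"
  proof (rule real_sqrt_unique)
    show "(exp (real CARD('n) * u x))\<^sup>2 = exp (2 * u x) ^ CARD('n)"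
      by (simp add: exp_of_nat_mult[symmetric] exp_double[symmetric] mult_ac)
  qed simp
  then show ?thesis
    unfolding vol_def det_scaleR by (simp add: abs_mult real_sqrt_mult)
qed

lemma vol_up_gh:
  assumes x: "x \<in> S"
  shows "vol_up s gh x I = exp (- real CARD('n) * u x) * vol_up s g x I"
proof -
  have "exp (real CARD('n) * u x) * exp (- 2 * u x) ^ CARD('n) = exp (- real CARD('n) * u x)"
    by (simp add: exp_of_nat_mult[symmetric] exp_add[symmetric])
  then show ?thesis
    unfolding vol_up_def vol_gh ginv_gh[OF x] prod.distrib prod_constant sum_distrib_left
    by (intro sum.cong refl) (simp add: mult_ac)
qed

lemma vol_mixed_gh:
  assumes x: "x \<in> S"
  shows "vol_mixed s gh x I = exp (- real CARD('n) * u x) * exp (2 * u x) * vol_mixed s g x I"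
  unfolding hat.vol_mixed_eq_lower_vol_up[OF x] vol_mixed_eq_lower_vol_up[OF x] vol_up_gh[OF x] sum_distrib_left
  by (intro sum.cong refl) (simp add: mult_ac)

lemma Phi_weyl_gh:
  "x \<in> S \<Longrightarrow> CARD('n) > 2 \<Longrightarrow> Phi_weyl k \<Phi> gh x I = Phi_weyl k \<Phi> g x I"
  unfolding Phi_weyl_def by (simp only: weyl_dudd_gh)

lemma p_poly_gh:
  assumes "x \<in> S" "CARD('n) > 2"
  shows "p_poly k \<Phi> s gh x = exp (- real CARD('n) * u x) * p_poly k \<Phi> s g x"
  unfolding p_poly_eq vol_up_gh[OF assms(1)] Phi_weyl_gh[OF assms]
  by (simp add: sum_distrib_left mult_ac)

lemma rho_gh:
  assumes x: "x \<in> S" and k: "k \<ge> 2" and n: "CARD('n) = 2 * k"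
    and \<Phi>: "homogeneous_invariant_polynomial k \<Phi>"
    and s: "continuous_on S s" "s ` S \<subseteq> {1, -1}"
  shows "rho k \<Phi> s gh x i = exp (- (2 * real k) * u x) * rho k \<Phi> s g x i"
proof -
  have n2: "CARD('n) > 2" and k1: "k \<ge> 1" using k n by simp_all
  let ?W = "weyl_dudd g x" and ?v = "vol_up s g x" and ?F = "Phi_weyl k \<Phi> g x"
  let ?c = "exp (- (2 * real k) * u x)"
  have nk: "- real CARD('n) = - (2 * real k)" using n by simp
  have alt: "alternating (2 * k) ?v"
    using alternating_vol_up[of s x] n by simp
  have trace: "real (2 * k) * (\<Sum>I\<in>multi1 (2 * k) m. ?v I * ?F (I(1 := l)))
      = (if l = m then (\<Sum>I\<in>multi (2 * k). ?v I * ?F I) else 0)" for l m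
  proof (rule contraction_eq_trace[OF n k1])
    show "alternating (2 * k) (\<lambda>I. ?v I * ?F I')" for I'
      using alt unfolding alternating_def by simp
    show "?v (I \<circ> Transposition.transpose 1 2) * ?F (I' \<circ> Transposition.transpose 1 2) = ?v I * ?F I'"
      if "I \<in> multi (2 * k)" for I I'
      using alternatingD[OF alt that, of 1 2] Phi_weyl_swap[OF x k1] k by simp
    show "?v (I \<circ> pair_exchange b) * ?F (I' \<circ> pair_exchange b) = ?v I * ?F I'"
      if "b \<in> {1..k}" "I \<in> multi (2 * k)" for b I I'
      using alternating_comp_pair_exchange[OF alt that] Phi_weyl_exchange[OF \<Phi> that(1)] by simp
  qed
  \<comment> \<open>The free index of $\epsilon_i{}^{i_2\cdots}$ is raised so that \<open>trace\<close> applies to the alternating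
    $\epsilon^{i_1\cdots}$. This turns the Kronecker delta into the metric.\<close>
  have mixed: "(\<Sum>I\<in>multi1 (2*k) i. vol_mixed s g x I * ?F (I(1 := l)))
      = g x $ i $ l * (\<Sum>I\<in>multi (2 * k). ?v I * ?F I) / (2 * real k)" for l
  proof -
    have "(\<Sum>I\<in>multi1 (2*k) i. vol_mixed s g x I * ?F (I(1 := l)))
        = (\<Sum>I\<in>multi1 (2*k) i. \<Sum>q\<in>UNIV. g x $ i $ q * (?v (I(1 := q)) * ?F (I(1 := q, 1 := l))))"
      unfolding vol_mixed_eq_lower_vol_up[OF x] sum_distrib_right
      by (intro sum.cong refl) (simp add: multi1_iff mult_ac)
    also have "\<dots> = (\<Sum>q\<in>UNIV. g x $ i $ q * (\<Sum>I\<in>multi1 (2*k) i. ?v (I(1 := q)) * ?F (I(1 := q, 1 := l))))"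
      unfolding sum_distrib_left by (rule sum.swap)
    also have "\<dots> = (\<Sum>q\<in>UNIV. g x $ i $ q * (\<Sum>I\<in>multi1 (2*k) q. ?v I * ?F (I(1 := l))))"
      using k1 by (subst sum_multi1_reindex[of "2 * k" "\<lambda>I. ?v I * ?F (I(1 := l))"]) auto
    also have "\<dots> = (\<Sum>q\<in>UNIV. g x $ i $ q * (if q = l then 1 else 0) * ((\<Sum>I\<in>multi (2 * k). ?v I * ?F I) / (2 * real k)))"
    proof (intro sum.cong refl)
      show "g x $ i $ q * (\<Sum>I\<in>multi1 (2*k) q. ?v I * ?F (I(1 := l)))
        = g x $ i $ q * (if q = l then 1 else 0) * ((\<Sum>I\<in>multi (2 * k). ?v I * ?F I) / (2 * real k))" for q
        using trace[of l q] k by (cases "q = l") (auto simp: field_simps)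
    qed
    finally show ?thesis
      by (simp only: sum_distrib_right[symmetric] sum_delta_mult) simp
  qed
  define Q where "Q R T I = (\<Prod>a\<in>{2..k}. ?W (T a) (R a) (I (2*a-1)) (I (2*a)))" for R T I :: "nat \<Rightarrow> 'n"
  have F1: "?F (I(1 := l)) = (\<Sum>R\<in>multi k. \<Sum>T\<in>multi k. \<Phi> R T * ?W (T 1) (R 1) l (I 2) * Q R T I)" for I l
  proof -
    have "(\<Prod>a\<in>{1..k}. ?W (T a) (R a) ((I(1 := l)) (2*a-1)) ((I(1 := l)) (2*a))) = ?W (T 1) (R 1) l (I 2) * Q R T I" for R T
    proof -
      have "(\<Prod>a\<in>{2..k}. ?W (T a) (R a) ((I(1 := l)) (2*a-1)) ((I(1 := l)) (2*a))) = Q R T I"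
        unfolding Q_def by (rule prod.cong[OF refl]) auto
      then show ?thesis
        using k1 by (subst prod_pairs_split) auto
    qed
    then show ?thesis unfolding Phi_weyl_def by (simp add: mult.assoc)
  qed
  let ?C = "\<lambda>I. \<Sum>R\<in>multi k. \<Sum>T\<in>multi k. vol_mixed s g x I * \<Phi> R T * cotton_dud g x (T 1) (R 1) (I 2) * Q R T I"
  have E: "?c * exp (2 * u x) * exp (- 2 * u x) = ?c"
    by (simp add: exp_minus)
  have summand: "(\<Sum>R\<in>multi k. \<Sum>T\<in>multi k. vol_mixed s gh x I * \<Phi> R T * cotton_dud gh x (T 1) (R 1) (I 2) *
        (\<Prod>a\<in>{2..k}. weyl_dudd gh x (T a) (R a) (I (2*a-1)) (I (2*a))))
      = ?c * (?C I + (\<Sum>l\<in>UNIV. grad x l * (vol_mixed s g x I * ?F (I(1 := l)))))" for I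
  proof -
    have "(\<Sum>R\<in>multi k. \<Sum>T\<in>multi k. vol_mixed s gh x I * \<Phi> R T * cotton_dud gh x (T 1) (R 1) (I 2) *
        (\<Prod>a\<in>{2..k}. weyl_dudd gh x (T a) (R a) (I (2*a-1)) (I (2*a))))
      = (\<Sum>R\<in>multi k. \<Sum>T\<in>multi k. ?c * (vol_mixed s g x I * \<Phi> R T * cotton_dud g x (T 1) (R 1) (I 2) * Q R T I
        + (\<Sum>l\<in>UNIV. grad x l * (vol_mixed s g x I * (\<Phi> R T * ?W (T 1) (R 1) l (I 2) * Q R T I)))))"
    proof (intro sum.cong refl)
      fix R T :: "nat \<Rightarrow> 'n"
      have "vol_mixed s gh x I * \<Phi> R T * cotton_dud gh x (T 1) (R 1) (I 2) * Q R T I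
        = ?c * exp (2 * u x) * exp (- 2 * u x) * (vol_mixed s g x I * \<Phi> R T *
          (cotton_dud g x (T 1) (R 1) (I 2) + (\<Sum>l\<in>UNIV. grad x l * ?W (T 1) (R 1) l (I 2))) * Q R T I)"
        unfolding vol_mixed_gh[OF x] cotton_dud_gh[OF x n2] nk by (simp only: mult_ac)
      also have "\<dots> = ?c * (vol_mixed s g x I * \<Phi> R T * cotton_dud g x (T 1) (R 1) (I 2) * Q R T I
        + (\<Sum>l\<in>UNIV. grad x l * (vol_mixed s g x I * (\<Phi> R T * ?W (T 1) (R 1) l (I 2) * Q R T I))))"
        unfolding E by (simp add: distrib_left distrib_right sum_distrib_left sum_distrib_right mult_ac)
      finally show "vol_mixed s gh x I * \<Phi> R T * cotton_dud gh x (T 1) (R 1) (I 2) *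
        (\<Prod>a\<in>{2..k}. weyl_dudd gh x (T a) (R a) (I (2*a-1)) (I (2*a)))
        = ?c * (vol_mixed s g x I * \<Phi> R T * cotton_dud g x (T 1) (R 1) (I 2) * Q R T I
        + (\<Sum>l\<in>UNIV. grad x l * (vol_mixed s g x I * (\<Phi> R T * ?W (T 1) (R 1) l (I 2) * Q R T I))))"
        unfolding weyl_dudd_gh[OF x n2] Q_def .
    qed
    also have "\<dots> = ?c * (?C I + (\<Sum>R\<in>multi k. \<Sum>T\<in>multi k. \<Sum>l\<in>UNIV.
        grad x l * (vol_mixed s g x I * (\<Phi> R T * ?W (T 1) (R 1) l (I 2) * Q R T I))))"
      by (simp only: sum_distrib_left[of ?c, symmetric] sum.distrib)
    also have "(\<Sum>R\<in>multi k. \<Sum>T\<in>multi k. \<Sum>l\<in>UNIV.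
        grad x l * (vol_mixed s g x I * (\<Phi> R T * ?W (T 1) (R 1) l (I 2) * Q R T I)))
      = (\<Sum>l\<in>UNIV. grad x l * (vol_mixed s g x I * ?F (I(1 := l))))"
      unfolding F1 sum_distrib_left
      by (subst (2) sum.swap, subst sum.swap, rule refl)
    finally show ?thesis .
  qed
  have "(\<Sum>I\<in>multi1 (2*k) i. \<Sum>l\<in>UNIV. grad x l * (vol_mixed s g x I * ?F (I(1 := l))))
      = (\<Sum>l\<in>UNIV. grad x l * (\<Sum>I\<in>multi1 (2*k) i. vol_mixed s g x I * ?F (I(1 := l))))"
    unfolding sum_distrib_left by (rule sum.swap)
  also have "\<dots> = (\<Sum>l\<in>UNIV. (g x $ i $ l * grad x l) * ((\<Sum>I\<in>multi (2 * k). ?v I * ?F I) / (2 * real k)))"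
    unfolding mixed by (intro sum.cong refl) simp
  also have "\<dots> = du x i * (\<Sum>I\<in>multi (2 * k). ?v I * ?F I) / (2 * real k)"
    unfolding sum_distrib_right[symmetric] sum_g_grad[OF x] by simp
  also have "(\<Sum>I\<in>multi (2 * k). ?v I * ?F I) = fact (2 * k) * p_poly k \<Phi> s g x"
    by (simp add: p_poly_eq)
  finally have "(\<Sum>I\<in>multi1 (2*k) i. \<Sum>l\<in>UNIV. grad x l * (vol_mixed s g x I * ?F (I(1 := l))))
      = du x i * (fact (2 * k) * p_poly k \<Phi> s g x) / (2 * real k)" .
  moreover have "(fact (2 * k) :: real) = 2 * real k * fact (2 * k - 1)"
    using k by (subst fact_reduce) auto
  ultimately have extra: "(\<Sum>I\<in>multi1 (2*k) i. \<Sum>l\<in>UNIV. grad x l * (vol_mixed s g x I * ?F (I(1 := l))))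
      = fact (2 * k - 1) * (du x i * p_poly k \<Phi> s g x)"
    using k by (simp only:) simp
  have dp: "pd i (p_poly k \<Phi> s gh) x = ?c * (pd i (p_poly k \<Phi> s g) x - 2 * real k * du x i * p_poly k \<Phi> s g x)"
    by (rule pd_exp_scaled[OF x _ p_poly_differentiable[OF x s]])
      (use p_poly_gh[OF _ n2] nk in simp)
  have "rho k \<Phi> s gh x i = 1 / fact (2*k-1) * (?c * ((\<Sum>I\<in>multi1 (2*k) i. ?C I) + fact (2 * k - 1) * (du x i * p_poly k \<Phi> s g x)))
      + 1 / (2 * real k) * (?c * (pd i (p_poly k \<Phi> s g) x - 2 * real k * du x i * p_poly k \<Phi> s g x))"
    unfolding rho_def summand dp sum_distrib_left[of ?c, symmetric] sum.distrib extra ..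
  also have "\<dots> = ?c * rho k \<Phi> s g x i"
    unfolding rho_def Q_def[symmetric] using k by (simp add: field_simps)
  finally show ?thesis .
qed

end

section \<open>Conformal invariance of \<open>\<xi>\<close> and \<open>\<rho>\<close>\<close>

lemma conformal_chart_of_manifold:
  fixes A :: "('a, 'n::finite) chart set"
  assumes M: "smooth_manifold X A" and g: "pseudo_riemannian_metric A g"
    and U: "smooth_function A \<Upsilon>" and c: "c \<in> A"
  shows "conformal_chart (coord c ` cdom c) (g c) (\<Upsilon> \<circ> point c)"
proof
  show "open (coord c ` cdom c)"
    using M c unfolding smooth_manifold_def by blast
  show "smooth_on (coord c ` cdom c) (\<lambda>x. g c x $ i $ j)" for i j
    using g c unfolding pseudo_riemannian_metric_def by blast
  show "Finite_Cartesian_Product.transpose (g c x) = g c x" "invertible (g c x)" if "x \<in> coord c ` cdom c" for x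
    using g c that unfolding pseudo_riemannian_metric_def by blast+
  show "smooth_on (coord c ` cdom c) (\<Upsilon> \<circ> point c)"
    using U c unfolding smooth_function_def by blast
qed

theorem theorem1p1:
  fixes X :: "'a topology"
    and A :: "('a, 'n::finite) chart set"
    and g :: "('a, 'n) chart \<Rightarrow> real^'n \<Rightarrow> real^'n^'n"
    and \<Upsilon> :: "'a \<Rightarrow> real"
    and k :: nat
  assumes "k \<ge> 2" and "CARD('n) = 2 * k"
    and "smooth_manifold X A"
    and "pseudo_riemannian_metric A g"
    and "smooth_function A \<Upsilon>"
  shows "(\<forall>c\<in>A. \<forall>p\<in>cdom c. \<forall>i.
            exp (2 * real k * \<Upsilon> p) * xi k (conformal_change \<Upsilon> g c) (coord c p) i
              = xi k (g c) (coord c p) i) \<and>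
         (\<forall>ori \<Phi>. orientation A ori \<longrightarrow> homogeneous_invariant_polynomial k \<Phi> \<longrightarrow>
            (\<forall>c\<in>A. \<forall>p\<in>cdom c. \<forall>i.
               exp (2 * real k * \<Upsilon> p) * rho k \<Phi> (ori c) (conformal_change \<Upsilon> g c) (coord c p) i
                 = rho k \<Phi> (ori c) (g c) (coord c p) i))"
proof -
  have conf: "conformal_change \<Upsilon> g c = (\<lambda>x. exp (2 * (\<Upsilon> \<circ> point c) x) *\<^sub>R g c x)" for c
    by (rule ext) (simp add: conformal_change_def)
  have pt: "(\<Upsilon> \<circ> point c) (coord c p) = \<Upsilon> p" if c: "c \<in> A" and p: "p \<in> cdom c" for c p
  proof -
    have "openin X (cdom c)"
      "homeomorphic_map (subtopology X (cdom c)) (top_of_set (coord c ` cdom c)) (coord c)"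
      using assms(3) c unfolding smooth_manifold_def by blast+
    then have "inj_on (coord c) (cdom c)"
      using homeomorphic_imp_injective_map openin_subset by (metis topspace_subtopology_subset)
    then show ?thesis
      using p by (simp add: point_def)
  qed
  have cancel: "exp (2 * real k * v) * (exp (- (2 * real k) * v) * r) = r" for v r
    by (simp add: exp_minus)
  show ?thesis
  proof (intro conjI ballI allI impI)
    fix c p i assume c: "c \<in> A" and p: "p \<in> cdom c"
    have x: "coord c p \<in> coord c ` cdom c" using p by blast
    note xi = conformal_chart.xi_gh[OF conformal_chart_of_manifold[OF assms(3-5) c] x assms(1,2)]
    show "exp (2 * real k * \<Upsilon> p) * xi k (conformal_change \<Upsilon> g c) (coord c p) i = xi k (g c) (coord c p) i"
      unfolding conf xi pt[OF c p] by (rule cancel)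
  next
    fix ori and \<Phi> :: "(nat \<Rightarrow> 'n) \<Rightarrow> (nat \<Rightarrow> 'n) \<Rightarrow> real" and c p i
    assume ori: "orientation A ori" and \<Phi>: "homogeneous_invariant_polynomial k \<Phi>"
      and c: "c \<in> A" and p: "p \<in> cdom c"
    have s: "continuous_on (coord c ` cdom c) (ori c)" "ori c ` (coord c ` cdom c) \<subseteq> {1, -1}"
      using ori c unfolding orientation_def by blast+
    have x: "coord c p \<in> coord c ` cdom c" using p by blast
    note rho = conformal_chart.rho_gh[OF conformal_chart_of_manifold[OF assms(3-5) c] x
        assms(1,2) \<Phi> s]
    show "exp (2 * real k * \<Upsilon> p) * rho k \<Phi> (ori c) (conformal_change \<Upsilon> g c) (coord c p) i
        = rho k \<Phi> (ori c) (g c) (coord c p) i"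
      unfolding conf rho pt[OF c p] by (rule cancel)
  qed
qed

end
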